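(* Let $n\ge 2$ and let $\mathcal{S}\subset\mathbb{R}^n$ be an $(n-1)$-dimensional $C^2$ surface, with or without boundary, oriented by a unit normal field $\mathbf{n}$, with curvature tensor $\mathbf{L}(z)$ and directional curvatures $k_{\mathbf{e}}(z)=\mathbf{e}\cdot\mathbf{L}(z)\mathbf{e}$. Then for all $z\in\mathcal{S}$, $$\mathbf{L}(z)=\frac{n-1}{2\,\omega_{n-2}}\int_{\mathcal{U}(T_z\mathcal{S})}k_{\mathbf{e}}(z)\,\big((n+1)\,\mathbf{e}\otimes\mathbf{e}-\mathbf{1}_{T_z\mathcal{S}}\big)\,d\mathbf{e}.$$
   Context: $T_z\mathcal{S}$ is the tangent space of $\mathcal{S}$ at $z$ (an $(n-1)$-dimensional subspace of $\mathbb{R}^n$), and $\mathbf{1}_{T_z\mathcal{S}}$ is the identity on it. $\mathcal{U}(T_z\mathcal{S})$ is the set of unit vectors in $T_z\mathcal{S}$, and $d\mathbf{e}$ is the $(n-2)$-dimensional surface (Hausdorff) measure on this unit sphere (counting measure if $n=2$). $\omega_{n-2}$ is the $(n-2)$-dimensional measure of the unit sphere in $\mathbb{R}^{n-1}$. The curvature tensor is $\mathbf{L}(z)=-{}^{s}\nabla\mathbf{n}(z)$, minus the surface gradient (differential along $\mathcal{S}$) of the unit normal at $z$, regarded as a (symmetric) linear map $T_z\mathcal{S}\to T_z\mathcal{S}$. For a unit vector $\mathbf{e}\in T_z\mathcal{S}$, the directional curvature in the direction $\mathbf{e}$ is $k_{\mathbf{e}}(z)=\mathbf{e}\cdot\mathbf{L}(z)\mathbf{e}$.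 The tensor product is $(\mathbf{a}\otimes\mathbf{b})\mathbf{c}=(\mathbf{b}\cdot\mathbf{c})\mathbf{a}$. *)

theory Defs
  imports "HOL-Analysis.Analysis"
begin

section \<open>Hausdorff measure\<close>

text \<open>
  The factor \<open>unit_ball_vol k / 2 ^ k\<close> is the normalisation for which the \<open>k\<close>-dimensional
  Hausdorff measure is the \<open>k\<close>-dimensional Euclidean volume. The empty set is treated
  separately because \<open>0 ^ 0 = 1\<close>: for \<open>k = 0\<close> a nonempty set has size 1, so that one obtains
  the counting measure.
\<close>
definition hausdorff_size :: "nat \<Rightarrow> 'a::metric_space set \<Rightarrow> ennreal" where
  "hausdorff_size k U =
     (if U = {} then 0 else ennreal (unit_ball_vol (real k) * (diameter U / 2) ^ k))"

definition hausdorff_content :: "nat \<Rightarrow> real \<Rightarrow> 'a::metric_space set \<Rightarrow> ennreal" where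
  "hausdorff_content k \<delta> A =
     (INF U \<in> {U :: nat \<Rightarrow> 'a set. A \<subseteq> (\<Union>i. U i) \<and> (\<forall>i. bounded (U i) \<and> diameter (U i) \<le> \<delta>)}.
        \<Sum>i. hausdorff_size k (U i))"

definition hausdorff_outer :: "nat \<Rightarrow> 'a::metric_space set \<Rightarrow> ennreal" where
  "hausdorff_outer k A = (SUP \<delta> \<in> {0<..}. hausdorff_content k \<delta> A)"

text \<open>
  \<open>hausdorff_outer k\<close> is a metric outer measure, hence countably additive on the Borel sets, so
  \<open>measure_of\<close> does not fall back to the zero measure here.
\<close>
definition hausdorff_measure :: "nat \<Rightarrow> 'a::metric_space measure" where
  "hausdorff_measure k = measure_of UNIV (sets borel) (hausdorff_outer k)"

section \<open>Surfaces of class \<open>C\<^sup>2\<close>\<close>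

definition C2_on :: "'b::real_normed_vector set \<Rightarrow> ('b \<Rightarrow> 'a::real_normed_vector) \<Rightarrow> bool" where
  "C2_on W f \<longleftrightarrow>
     (\<exists>(f' :: 'b \<Rightarrow> 'b \<Rightarrow>\<^sub>L 'a) (f'' :: 'b \<Rightarrow> 'b \<Rightarrow>\<^sub>L 'b \<Rightarrow>\<^sub>L 'a).
        (\<forall>x\<in>W. (f has_derivative blinfun_apply (f' x)) (at x)) \<and>
        (\<forall>x\<in>W. (f' has_derivative blinfun_apply (f'' x)) (at x)) \<and>
        continuous_on W f'')"

text \<open>
  Embedded \<open>C\<^sup>2\<close> submanifolds, with or without boundary, of dimension \<open>DIM('b)\<close>. Every point
  has a regular \<open>C\<^sup>2\<close> parametrisation whose parameter domain is a relatively open subset of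
  \<open>'b\<close> itself or of a closed half-space of \<open>'b\<close>; in the latter case, smoothness up to the
  boundary means that the parametrisation is the restriction of a \<open>C\<^sup>2\<close> map on an open set \<open>W\<close>
  of \<open>'b\<close>.
\<close>
definition C2_surface :: "'b::euclidean_space itself \<Rightarrow> 'a::euclidean_space set \<Rightarrow> bool" where
  "C2_surface _ S \<longleftrightarrow>
     (\<forall>z\<in>S. \<exists>U W H. \<exists>\<phi> :: 'b \<Rightarrow> 'a. \<exists>\<psi>.
        open U \<and> z \<in> U \<and> open W \<and> (H = UNIV \<or> (\<exists>a. a \<noteq> 0 \<and> H = {x. 0 \<le> a \<bullet> x})) \<and>
        C2_on W \<phi> \<and> (\<forall>x \<in> W \<inter> H. inj (frechet_derivative \<phi> (at x))) \<and>
        homeomorphism (W \<inter> H) (S \<inter> U) \<phi> \<psi>)"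

text \<open>
  The span of the velocities at \<open>z\<close> of the curves in \<open>S\<close> starting at \<open>z\<close>. At a boundary point
  these velocities form only a closed half-space of the tangent space, hence the span.
\<close>
definition tangent_space :: "'a::euclidean_space set \<Rightarrow> 'a \<Rightarrow> 'a set" where
  "tangent_space S z =
     span {v. \<exists>\<gamma> :: real \<Rightarrow> 'a. \<gamma> 0 = z \<and> \<gamma> ` {0..1} \<subseteq> S \<and>
                (\<gamma> has_vector_derivative v) (at 0 within {0..1})}"

definition unit_tangents :: "'a::euclidean_space set \<Rightarrow> 'a \<Rightarrow> 'a set" where
  "unit_tangents S z = {e \<in> tangent_space S z. norm e = 1}"

text \<open>
  An orientation is a continuous choice of unit normal; on a \<open>C\<^sup>2\<close> surface of codimension one,
  such a field is automatically of class \<open>C\<^sup>1\<close> along \<open>S\<close>.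
\<close>
definition unit_normal_field :: "'a::euclidean_space set \<Rightarrow> ('a \<Rightarrow> 'a) \<Rightarrow> bool" where
  "unit_normal_field S N \<longleftrightarrow>
     continuous_on S N \<and>
     (\<forall>z\<in>S. norm (N z) = 1 \<and> (\<forall>v \<in> tangent_space S z. N z \<bullet> v = 0))"

section \<open>Curvature\<close>

text \<open>
  The derivative of \<open>N\<close> within \<open>S\<close> is determined on \<open>tangent_space S z\<close> only, and it is the
  differential of \<open>N\<close> along \<open>S\<close> there. \<open>curvature_tensor S N z\<close> is therefore meaningful only
  on tangent vectors.
\<close>
definition curvature_tensor ::
    "'a::euclidean_space set \<Rightarrow> ('a \<Rightarrow> 'a) \<Rightarrow> 'a \<Rightarrow> 'a \<Rightarrow> 'a" where
  "curvature_tensor S N z v = - frechet_derivative N (at z within S) v"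

definition directional_curvature ::
    "'a::euclidean_space set \<Rightarrow> ('a \<Rightarrow> 'a) \<Rightarrow> 'a \<Rightarrow> 'a \<Rightarrow> real" where
  "directional_curvature S N z e = e \<bullet> curvature_tensor S N z e"

text \<open>
  A linear map of a tangent space \<open>T\<close> can be represented by any matrix of the ambient space that
  agrees with it on \<open>T\<close>; in particular, \<open>mat 1\<close> represents the identity of \<open>T\<close>.
\<close>

definition tensor :: "real ^ 'n \<Rightarrow> real ^ 'm \<Rightarrow> real ^ 'm ^ 'n"  (infixl "\<otimes>\<^sub>t" 75) where
  "a \<otimes>\<^sub>t b = (\<chi> i j. a $ i * b $ j)"

lemma tensor_mult_vec: "(a \<otimes>\<^sub>t b) *v c = (b \<bullet> c) *\<^sub>R a"
  by (simp add: vec_eq_iff tensor_def matrix_vector_mult_def inner_vec_def sum_distrib_left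
      mult_ac)

end

(* Along a parametrisation, a continuous unit normal is orthogonal to a C^1 frame, which makes it
   differentiable and expresses its derivative through the second derivative of the
   parametrisation; so L is a symmetric endomorphism of the tangent space T, the orthogonal
   complement of the normal. The Hausdorff measure of the unit sphere of T is finite, positive and
   invariant under the reflections of T, so the integral of (e . x)^4 is c |x|^4. Polarization gives
   all fourth moments of the sphere, traces give the second moments and the value of c, and the
   formula follows by expanding k_e (e . x)(e . y) in an orthonormal basis of T. *)
theory Submission
  imports Defs
begin

text \<open>Default values shape the measure-theoretic half: \<open>measure_of\<close> yields the
  zero measure unless the outer measure is countably additive on the Borel sets, an integral that
  does not exist is 0, and so is a quotient by 0. Hence Caratheodory's criterion and both bounds for
  the sphere are needed before any integral can be evaluated. The numerical value of \<omega> never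
  enters. The integrand is quartic in e, reflections act transitively on the vectors of T of a given
  norm, and |e|^2 = 1 ties the lower moments to the quartic ones, so \<omega> is known as a multiple
  of their constant c, which then cancels. The factor n + 1 = dim T + 2 is the one that removes the
  trace of L. On the geometric side N is only continuous by hypothesis, and
  \<open>frechet_derivative\<close> within S selects one of several linear maps that differ off the
  tangent space. Existence and tangential uniqueness of the derivative must therefore be proved,
  also at boundary points, where S is reached from one side only.\<close>

section \<open>Metric outer measures and Hausdorff measure\<close>

text \<open>
  \<open>A - F\<close> is exhausted by the sets \<open>An n\<close>; the shells \<open>Bn n\<close> between them are positively separated
  from each other when their indices differ by at least 2, so the sum over each parity class is
  at most \<open>f A\<close> and the tails of the series vanish.
\<close>
lemma metric_outer_measure_closed:
  fixes f :: "'a::metric_space set \<Rightarrow> ennreal"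
  assumes oms: "outer_measure_space UNIV f"
    and sep: "\<And>A B d. 0 < d \<Longrightarrow> (\<And>a b. a \<in> A \<Longrightarrow> b \<in> B \<Longrightarrow> d \<le> dist a b) \<Longrightarrow> f A + f B \<le> f (A \<union> B)"
    and F: "closed F"
  shows "f (A \<inter> F) + f (A - F) \<le> f A"
proof (cases "F = {} \<or> f A = top")
  case True
  then show ?thesis using oms by (auto simp: outer_measure_space_def positive_def)
next
  case False
  then have ne: "F \<noteq> {}" and fin: "f A < top" by (auto simp: less_top)
  have inc: "f X \<le> f Y" if "X \<subseteq> Y" for X Y
    using oms that by (auto simp: outer_measure_space_def increasing_def)
  have e0: "f {} = 0" using oms by (auto simp: outer_measure_space_def positive_def)
  have csub: "f (\<Union>i. X i) \<le> (\<Sum>i. f (X i))" for X :: "nat \<Rightarrow> 'a set"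
  proof -
    \<comment> \<open>\<open>countably_subadditive\<close> speaks of disjoint families; making the
      sets disjoint only shrinks them, and f is increasing.\<close>
    have "f (\<Union>i. disjointed X i) \<le> (\<Sum>i. f (disjointed X i))"
      using oms disjoint_family_disjointed[of X]
      unfolding outer_measure_space_def countably_subadditive_def by blast
    also have "\<dots> \<le> (\<Sum>i. f (X i))"
      by (intro suminf_le inc disjointed_subset summableI)
    finally show ?thesis by (simp add: UN_disjointed_eq)
  qed
  have sub: "f (X \<union> Y) \<le> f X + f Y" for X Y
  proof -
    have "f (\<Union>i. case i of 0 \<Rightarrow> X | Suc 0 \<Rightarrow> Y | _ \<Rightarrow> {}) \<le>
        (\<Sum>i. f (case i of 0 \<Rightarrow> X | Suc 0 \<Rightarrow> Y | _ \<Rightarrow> {}))"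
      by (rule csub)
    also have "\<dots> = (\<Sum>i\<in>{0, 1}. f (case i of 0 \<Rightarrow> X | Suc 0 \<Rightarrow> Y | _ \<Rightarrow> {}))"
      by (rule suminf_finite) (auto split: nat.split simp: e0)
    also have "(\<Union>i. case i of 0 \<Rightarrow> X | Suc 0 \<Rightarrow> Y | _ \<Rightarrow> {}) = X \<union> Y"
      by (auto split: nat.splits)
    finally show ?thesis by simp
  qed
  define An where "An n = {x \<in> A. inverse (Suc n) \<le> infdist x F}" for n
  define Bn where "Bn n = {x \<in> A. inverse (Suc (Suc n)) \<le> infdist x F \<and> infdist x F < inverse (Suc n)}" for n
  have An_sep: "f (A \<inter> F) + f (An n) \<le> f A" for n
  proof -
    have "f (A \<inter> F) + f (An n) \<le> f ((A \<inter> F) \<union> An n)"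
    proof (rule sep[of "inverse (Suc n)"])
      fix a b assume "a \<in> A \<inter> F" "b \<in> An n"
      then show "inverse (Suc n) \<le> dist a b"
        using infdist_le[of a F b] by (simp add: An_def dist_commute)
    qed simp
    also have "\<dots> \<le> f A" by (rule inc) (auto simp: An_def)
    finally show ?thesis .
  qed
  have Bsep: "f (Bn n) + f X \<le> f (Bn n \<union> X)" if "X \<subseteq> {x. inverse (Suc n) + \<delta> \<le> infdist x F}" "0 < \<delta>" for n X \<delta>
  proof (rule sep[of \<delta>])
    fix a b assume "a \<in> Bn n" "b \<in> X"
    moreover have "infdist b F \<le> infdist a F + dist b a" by (rule infdist_triangle)
    ultimately show "\<delta> \<le> dist a b" using that by (auto simp: Bn_def dist_commute)
  qed fact
  have Bsum: "(\<Sum>k<n. f (Bn (2 * k + j))) \<le> f (\<Union>k<n. Bn (2 * k + j))" for n j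
  proof (induction n)
    case (Suc n)
    \<comment> \<open>Points of the earlier shells have distance at least 1/(2n+j) from F, those of
      the new one less than 1/(2n+j+1); \<delta> is the gap. For n = 0 the union is empty and 2n+j
      may be 0, whose \<open>inverse\<close> is 0, so any positive value is taken.\<close>
    define \<delta> where "\<delta> = (if n = 0 then 1 else inverse (real (2 * n + j)) - inverse (Suc (2 * n + j)))"
    have "0 < \<delta>"
      by (auto simp: \<delta>_def intro!: less_imp_inverse_less)
    have "inverse (Suc (2 * n + j)) + \<delta> \<le> inverse (real (Suc (Suc (2 * k + j))))" if "k < n" for k
    proof -
      have "inverse (real (2 * n + j)) \<le> inverse (real (Suc (Suc (2 * k + j))))"
        using that by (intro le_imp_inverse_le) auto
      then show ?thesis using that by (simp add: \<delta>_def)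
    qed
    then have "(\<Union>k<n. Bn (2 * k + j)) \<subseteq> {x. inverse (Suc (2 * n + j)) + \<delta> \<le> infdist x F}"
      by (fastforce simp: Bn_def)
    from Bsep[OF this \<open>0 < \<delta>\<close>]
    have "f (Bn (2 * n + j)) + f (\<Union>k<n. Bn (2 * k + j)) \<le> f (\<Union>k<Suc n. Bn (2 * k + j))"
      by (simp add: lessThan_Suc)
    moreover have "(\<Sum>k<Suc n. f (Bn (2 * k + j))) \<le> f (Bn (2 * n + j)) + f (\<Union>k<n. Bn (2 * k + j))"
      using Suc by (simp add: add.commute add_left_mono)
    ultimately show ?case by (rule order_trans[rotated])
  qed (simp add: e0)
  have "(\<Sum>k<n. f (Bn k)) \<le> f A + f A" for n
  proof -
    have "(\<Sum>k<n. f (Bn k)) \<le> (\<Sum>k<2 * n. f (Bn k))"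
      by (intro sum_mono2) auto
    also have "\<dots> = (\<Sum>k<n. f (Bn (2 * k + 0))) + (\<Sum>k<n. f (Bn (2 * k + 1)))"
      by (induction n) (auto simp: ac_simps)
    also have "\<dots> \<le> f (\<Union>k<n. Bn (2 * k + 0)) + f (\<Union>k<n. Bn (2 * k + 1))"
      by (intro add_mono Bsum)
    also have "\<dots> \<le> f A + f A"
      by (intro add_mono inc) (auto simp: Bn_def)
    finally show ?thesis .
  qed
  then have "(\<Sum>k. f (Bn k)) \<le> f A + f A"
    by (intro suminf_le_const summableI)
  then have Bfin: "(\<Sum>k. f (Bn k)) < top"
    using fin by (auto simp: less_top[symmetric] top_unique)
  have cover: "A - F \<subseteq> An n \<union> (\<Union>k. Bn (k + n))" for n
  proof
    fix x assume x: "x \<in> A - F"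
    then have "0 < infdist x F"
      using F ne by (metis DiffD2 in_closed_iff_infdist_zero infdist_nonneg less_eq_real_def)
    then obtain m where m: "inverse (Suc m) < infdist x F"
      using reals_Archimedean by auto
    show "x \<in> An n \<union> (\<Union>k. Bn (k + n))"
    proof (cases "x \<in> An n")
      case False
      \<comment> \<open>The shell of x has index p - 1, and lying outside \<open>An n\<close> forces
        p - 1 \<ge> n.\<close>
      define p where "p = (LEAST m. inverse (Suc m) \<le> infdist x F)"
      have p: "inverse (Suc p) \<le> infdist x F"
        unfolding p_def by (rule LeastI[where k = m]) (use m in auto)
      have np: "infdist x F < inverse (Suc q)" if "q < p" for q
        using not_less_Least[of q "\<lambda>m. inverse (real (Suc m)) \<le> infdist x F"] that by (auto simp: p_def not_le)
      have lt: "infdist x F < inverse (Suc n)" using False x by (auto simp: An_def)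
      have "n < p"
      proof (rule ccontr)
        assume "\<not> n < p"
        then have "inverse (real (Suc n)) \<le> inverse (Suc p)" by (intro le_imp_inverse_le) auto
        with lt p show False by linarith
      qed
      then have "x \<in> Bn ((p - 1 - n) + n)"
        using p np[of "p - 1"] x by (auto simp: Bn_def)
      then show ?thesis by blast
    qed simp
  qed
  have le: "f (A \<inter> F) + f (A - F) \<le> f A + (\<Sum>k. f (Bn (k + n)))" for n
  proof -
    have "f (A \<inter> F) + f (A - F) \<le> f (A \<inter> F) + (f (An n) + f (\<Union>k. Bn (k + n)))"
      by (intro add_left_mono order_trans[OF inc[OF cover] sub])
    also have "\<dots> \<le> f (A \<inter> F) + f (An n) + (\<Sum>k. f (Bn (k + n)))"
      unfolding add.assoc by (intro add_left_mono csub)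
    also have "\<dots> \<le> f A + (\<Sum>k. f (Bn (k + n)))"
      by (intro add_right_mono An_sep)
    finally show ?thesis .
  qed
  have "(\<lambda>n. \<Sum>k. f (Bn (k + n))) \<longlonglongrightarrow> 0"
  proof -
    \<comment> \<open>Finiteness of f A moves the series to the reals, where tails of a convergent
      series tend to 0.\<close>
    have Bk: "f (Bn k) = ennreal (enn2real (f (Bn k)))" for k
    proof -
      have "f (Bn k) \<le> f A" by (rule inc) (auto simp: Bn_def)
      then show ?thesis using fin by (simp add: ennreal_enn2real le_less_trans)
    qed
    have sm: "summable (\<lambda>k. enn2real (f (Bn k)))"
      by (rule summable_suminf_not_top) (use Bfin Bk in simp_all)
    have "(\<lambda>n. \<Sum>k. enn2real (f (Bn (k + n)))) \<longlonglongrightarrow> 0"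
      by (rule suminf_exist_split2[OF sm])
    then have "(\<lambda>n. ennreal (\<Sum>k. enn2real (f (Bn (k + n))))) \<longlonglongrightarrow> ennreal 0"
      by (rule tendsto_ennrealI)
    moreover have "ennreal (\<Sum>k. enn2real (f (Bn (k + n)))) = (\<Sum>k. f (Bn (k + n)))" for n
      by (subst Bk, rule suminf_ennreal2[symmetric]) (auto intro: summable_ignore_initial_segment sm)
    ultimately show ?thesis by simp
  qed
  then have "(\<lambda>n. f A + (\<Sum>k. f (Bn (k + n)))) \<longlonglongrightarrow> f A + 0"
    by (intro tendsto_add tendsto_const)
  then show ?thesis
    using le by (intro Lim_bounded2[where N = 0]) auto
qed

text \<open>Caratheodory: the sets that split every set additively form a sigma-algebra on which f
  is a measure. Closed sets belong to it by the preceding lemma, and they generate the Borel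
  sets.\<close>

lemma metric_outer_measure_borel:
  fixes f :: "'a::metric_space set \<Rightarrow> ennreal"
  assumes oms: "outer_measure_space UNIV f"
    and sep: "\<And>A B d. 0 < d \<Longrightarrow> (\<And>a b. a \<in> A \<Longrightarrow> b \<in> B \<Longrightarrow> d \<le> dist a b) \<Longrightarrow> f A + f B \<le> f (A \<union> B)"
  shows "measure_space UNIV (sets borel) f"
proof -
  interpret sigma_algebra UNIV "UNIV :: 'a set set"
    using sigma_algebra_Pow[of "UNIV :: 'a set"] by simp
  define L where "L = lambda_system UNIV UNIV f"
  have ms: "measure_space UNIV L f"
    unfolding L_def by (rule caratheodory_lemma[OF oms])
  have sub: "f X \<le> f (X \<inter> F) + f (X - F)" for X F
  proof -
    have "subadditive UNIV f"
      using oms countably_subadditive_subadditive unfolding outer_measure_space_def by blast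
    then have "f ((X \<inter> F) \<union> (X - F)) \<le> f (X \<inter> F) + f (X - F)"
      by (intro subadditiveD) auto
    then show ?thesis by (simp add: Int_Diff_Un)
  qed
  have "F \<in> L" if "closed F" for F
    unfolding L_def lambda_system_eq
    using antisym[OF metric_outer_measure_closed[OF oms sep that] sub] by auto
  then have "sigma_sets UNIV (Collect closed) \<subseteq> L"
    using ms by (intro sigma_algebra.sigma_sets_subset) (auto simp: measure_space_def)
  moreover have "sets (borel :: 'a measure) = sigma_sets UNIV (Collect closed)"
    by (simp add: borel_eq_closed)
  ultimately show ?thesis
    using ms by (intro measure_down[OF ms]) (auto intro: sigma_algebra_sigma_sets)
qed

section \<open>Hausdorff content, its supremum over the scales, and separated sets\<close>

lemma diameter_le_dist:
  assumes "0 \<le> d" "\<And>x y. x \<in> S \<Longrightarrow> y \<in> S \<Longrightarrow> dist x y \<le> d"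
  shows "diameter S \<le> d"
  using assms by (auto simp: diameter_def intro!: cSUP_least)

lemma hausdorff_size_empty [simp]: "hausdorff_size k {} = 0"
  by (simp add: hausdorff_size_def)

lemma hausdorff_content_le:
  assumes "A \<subseteq> (\<Union>i. U i)" "\<And>i. bounded (U i)" "\<And>i. diameter (U i) \<le> \<delta>"
  shows "hausdorff_content k \<delta> A \<le> (\<Sum>i. hausdorff_size k (U i))"
  unfolding hausdorff_content_def using assms by (intro INF_lower) auto

lemma hausdorff_content_mono: "A \<subseteq> B \<Longrightarrow> hausdorff_content k \<delta> A \<le> hausdorff_content k \<delta> B"
  unfolding hausdorff_content_def by (intro INF_superset_mono) auto

lemma hausdorff_content_antimono: "\<delta> \<le> \<delta>' \<Longrightarrow> hausdorff_content k \<delta>' A \<le> hausdorff_content k \<delta> A"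
  unfolding hausdorff_content_def by (intro INF_superset_mono order_refl) (use order_trans in blast)

lemma hausdorff_content_empty: "0 \<le> \<delta> \<Longrightarrow> hausdorff_content k \<delta> {} = 0"
  using hausdorff_content_le[of "{}" "\<lambda>_. {}" \<delta> k] by simp

text \<open>Almost optimal covers of the A i, with excess eps/2^(i+1), are merged into one sequence
  by \<open>prod_decode\<close>; the excesses add up to eps.\<close>

lemma hausdorff_content_UN_le:
  "hausdorff_content k \<delta> (\<Union>i::nat. A i) \<le> (\<Sum>i. hausdorff_content k \<delta> (A i))"
proof (cases "(\<Sum>i. hausdorff_content k \<delta> (A i)) = top")
  case False
  show ?thesis
  proof (rule ennreal_le_epsilon)
    fix \<epsilon> :: real assume "0 < \<epsilon>"
    have "\<exists>V. (A i \<subseteq> (\<Union>j. V j) \<and> (\<forall>j. bounded (V j) \<and> diameter (V j) \<le> \<delta>)) \<and>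
        (\<Sum>j. hausdorff_size k (V j)) \<le> hausdorff_content k \<delta> (A i) + ennreal (\<epsilon> * (1/2) ^ Suc i)" for i
    proof -
      have "hausdorff_content k \<delta> (A i) \<noteq> top"
        using False ennreal_suminf_lessD[of "\<lambda>i. hausdorff_content k \<delta> (A i)" top i] by (simp add: less_top)
      moreover have "0 < ennreal (\<epsilon> * (1/2) ^ Suc i)" using \<open>0 < \<epsilon>\<close> by simp
      ultimately have "hausdorff_content k \<delta> (A i) < hausdorff_content k \<delta> (A i) + ennreal (\<epsilon> * (1/2) ^ Suc i)"
        by (simp add: ennreal_add_left_cancel_less)
      then have "\<exists>V\<in>{V. A i \<subseteq> (\<Union>j. V j) \<and> (\<forall>j. bounded (V j) \<and> diameter (V j) \<le> \<delta>)}.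
          (\<Sum>j. hausdorff_size k (V j)) < hausdorff_content k \<delta> (A i) + ennreal (\<epsilon> * (1/2) ^ Suc i)"
        unfolding hausdorff_content_def[of k \<delta> "A i"] by (subst (asm) INF_less_iff)
      then show ?thesis using less_imp_le by blast
    qed
    then obtain V where V: "\<And>i. A i \<subseteq> (\<Union>j. V i j)" "\<And>i j. bounded (V i j)" "\<And>i j. diameter (V i j) \<le> \<delta>"
      "\<And>i. (\<Sum>j. hausdorff_size k (V i j)) \<le> hausdorff_content k \<delta> (A i) + ennreal (\<epsilon> * (1/2) ^ Suc i)"
      by metis
    have "hausdorff_content k \<delta> (\<Union>i. A i) \<le> (\<Sum>n. hausdorff_size k (case_prod V (prod_decode n)))"
    proof (rule hausdorff_content_le)
      show "(\<Union>i. A i) \<subseteq> (\<Union>n. case_prod V (prod_decode n))"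
      proof
        fix x assume "x \<in> (\<Union>i. A i)"
        then obtain i j where "x \<in> V i j" using V(1) by blast
        then have "x \<in> case_prod V (prod_decode (prod_encode (i, j)))" by simp
        then show "x \<in> (\<Union>n. case_prod V (prod_decode n))" by (rule UN_I[OF UNIV_I])
      qed
      show "bounded (case_prod V (prod_decode n))" "diameter (case_prod V (prod_decode n)) \<le> \<delta>" for n
        by (simp_all add: split_def V(2,3))
    qed
    also have "\<dots> = (\<Sum>i. \<Sum>j. hausdorff_size k (V i j))"
      using suminf_ennreal_2dimen[of "\<lambda>i. \<Sum>j. hausdorff_size k (V i j)" "\<lambda>(i, j). hausdorff_size k (V i j)"]
      by (simp add: o_def split_def)
    also have "\<dots> \<le> (\<Sum>i. hausdorff_content k \<delta> (A i) + ennreal (\<epsilon> * (1/2) ^ Suc i))"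
      by (intro suminf_le V summableI)
    also have "\<dots> = (\<Sum>i. hausdorff_content k \<delta> (A i)) + (\<Sum>i. ennreal (\<epsilon> * (1/2) ^ Suc i))"
      by (intro suminf_add[symmetric] summableI)
    also have "(\<Sum>i. ennreal (\<epsilon> * (1/2) ^ Suc i)) = ennreal \<epsilon>"
      using sums_mult[OF power_half_series, of \<epsilon>] \<open>0 < \<epsilon>\<close>
      by (intro sums_unique[symmetric] sums_ennreal[THEN iffD2]) simp_all
    finally show "hausdorff_content k \<delta> (\<Union>i. A i) \<le> (\<Sum>i. hausdorff_content k \<delta> (A i)) + ennreal \<epsilon>" .
  qed
qed simp

lemma hausdorff_content_le_outer: "0 < \<delta> \<Longrightarrow> hausdorff_content k \<delta> A \<le> hausdorff_outer k A"
  unfolding hausdorff_outer_def by (intro SUP_upper) simp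

lemma hausdorff_outer_leI: "(\<And>\<delta>. 0 < \<delta> \<Longrightarrow> hausdorff_content k \<delta> A \<le> c) \<Longrightarrow> hausdorff_outer k A \<le> c"
  unfolding hausdorff_outer_def by (intro SUP_least) simp

lemma hausdorff_outer_mono: "A \<subseteq> B \<Longrightarrow> hausdorff_outer k A \<le> hausdorff_outer k B"
  by (intro hausdorff_outer_leI order_trans[OF hausdorff_content_mono hausdorff_content_le_outer])

lemma outer_measure_space_hausdorff_outer:
  "outer_measure_space UNIV (hausdorff_outer k :: 'a::metric_space set \<Rightarrow> ennreal)"
proof -
  have "hausdorff_outer k (\<Union>i. A i) \<le> (\<Sum>i. hausdorff_outer k (A i))" for A :: "nat \<Rightarrow> 'a set"
    by (intro hausdorff_outer_leI order_trans[OF hausdorff_content_UN_le] suminf_le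
        hausdorff_content_le_outer summableI)
  moreover have "hausdorff_outer k ({} :: 'a set) = 0"
    using hausdorff_outer_leI[of k "{} :: 'a set" 0] by (simp add: hausdorff_content_empty)
  ultimately show ?thesis
    by (auto simp: outer_measure_space_def positive_def increasing_def countably_subadditive_def
        intro: hausdorff_outer_mono)
qed

text \<open>A set of diameter at most \<delta> < d cannot meet both A and B, so a cover of the union
  splits into a cover of A and one of B.\<close>

lemma hausdorff_content_separated:
  assumes sep: "\<And>a b. a \<in> A \<Longrightarrow> b \<in> B \<Longrightarrow> d \<le> dist a b" and "\<delta> < d"
  shows "hausdorff_content k \<delta> A + hausdorff_content k \<delta> B \<le> hausdorff_content k \<delta> (A \<union> B)"
  unfolding hausdorff_content_def[of k \<delta> "A \<union> B"]
proof (rule INF_greatest)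
  fix U assume "U \<in> {U :: nat \<Rightarrow> 'a set. A \<union> B \<subseteq> (\<Union>i. U i) \<and> (\<forall>i. bounded (U i) \<and> diameter (U i) \<le> \<delta>)}"
  then have U: "A \<union> B \<subseteq> (\<Union>i. U i)" "\<And>i. bounded (U i)" "\<And>i. diameter (U i) \<le> \<delta>" by auto
  \<comment> \<open>Sets that miss X become empty, at size 0, instead of being dropped: the indices
    stay, and the series can be compared term by term.\<close>
  define V where "V X i = (if U i \<inter> X = {} then {} else U i)" for X i
  have V: "hausdorff_content k \<delta> X \<le> (\<Sum>i. hausdorff_size k (V X i))" if "X \<subseteq> A \<union> B" for X
  proof (rule hausdorff_content_le)
    show "X \<subseteq> (\<Union>i. V X i)" using that U(1) by (fastforce simp: V_def)
    show "diameter (V X i) \<le> \<delta>" for i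
      using U(3)[of i] diameter_ge_0[OF U(2)[of i]] by (auto simp: V_def)
  qed (simp add: V_def U)
  have le: "hausdorff_size k (V A i) + hausdorff_size k (V B i) \<le> hausdorff_size k (U i)" for i
  proof (cases "U i \<inter> A = {} \<or> U i \<inter> B = {}")
    case False
    then obtain a b where ab: "a \<in> U i" "a \<in> A" "b \<in> U i" "b \<in> B" by blast
    then have "dist a b \<le> \<delta>" using diameter_bounded_bound[OF U(2) ab(1,3)] U(3)[of i] by simp
    then show ?thesis using sep[OF ab(2,4)] assms(2) by simp
  qed (auto simp: V_def)
  have "hausdorff_content k \<delta> A + hausdorff_content k \<delta> B \<le>
      (\<Sum>i. hausdorff_size k (V A i)) + (\<Sum>i. hausdorff_size k (V B i))"
    by (intro add_mono V) auto
  also have "\<dots> = (\<Sum>i. hausdorff_size k (V A i) + hausdorff_size k (V B i))"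
    by (intro suminf_add summableI)
  also have "\<dots> \<le> (\<Sum>i. hausdorff_size k (U i))" by (intro suminf_le le summableI)
  finally show "hausdorff_content k \<delta> A + hausdorff_content k \<delta> B \<le> (\<Sum>i. hausdorff_size k (U i))" .
qed

lemma hausdorff_outer_separated:
  assumes "0 < d" and sep: "\<And>a b. a \<in> A \<Longrightarrow> b \<in> B \<Longrightarrow> d \<le> dist a b"
  shows "hausdorff_outer k A + hausdorff_outer k B \<le> hausdorff_outer k (A \<union> B)"
proof -
  \<comment> \<open>With independent scales for A and B the two suprema can be taken one after the
    other; a common scale below d gives the estimate.\<close>
  have "hausdorff_content k \<delta>1 A + hausdorff_content k \<delta>2 B \<le> hausdorff_outer k (A \<union> B)"
    if "0 < \<delta>1" "0 < \<delta>2" for \<delta>1 \<delta>2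
  proof -
    define \<delta> where "\<delta> = min (min \<delta>1 \<delta>2) (d / 2)"
    have \<delta>: "0 < \<delta>" "\<delta> < d" "\<delta> \<le> \<delta>1" "\<delta> \<le> \<delta>2" using that \<open>0 < d\<close> by (auto simp: \<delta>_def)
    have "hausdorff_content k \<delta>1 A + hausdorff_content k \<delta>2 B \<le> hausdorff_content k \<delta> A + hausdorff_content k \<delta> B"
      by (intro add_mono hausdorff_content_antimono \<delta>)
    also have "\<dots> \<le> hausdorff_content k \<delta> (A \<union> B)"
      by (rule hausdorff_content_separated[OF sep \<delta>(2)])
    also have "\<dots> \<le> hausdorff_outer k (A \<union> B)" by (rule hausdorff_content_le_outer[OF \<delta>(1)])
    finally show ?thesis .
  qed
  then have "hausdorff_content k \<delta> A + hausdorff_outer k B \<le> hausdorff_outer k (A \<union> B)" if "0 < \<delta>" for \<delta>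
    unfolding hausdorff_outer_def[of k B] using that
    by (subst ennreal_SUP_add_right) (auto intro!: SUP_least)
  then show ?thesis
    unfolding hausdorff_outer_def[of k A]
    by (subst ennreal_SUP_add_left[symmetric]) (auto intro!: SUP_least)
qed

section \<open>The measure and its transport along isometries\<close>

lemma space_hausdorff_measure [simp]: "space (hausdorff_measure k) = UNIV"
  by (simp add: hausdorff_measure_def)

lemma sets_hausdorff_measure [simp, measurable_cong]: "sets (hausdorff_measure k) = sets borel"
  using sets.sigma_sets_eq[of borel] by (simp add: hausdorff_measure_def sets_measure_of)

lemma emeasure_hausdorff_measure:
  assumes "A \<in> sets borel"
  shows "emeasure (hausdorff_measure k) A = hausdorff_outer k A"
proof -
  have "measure_space UNIV (sets borel) (hausdorff_outer k :: 'a set \<Rightarrow> ennreal)"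
    by (rule metric_outer_measure_borel[OF outer_measure_space_hausdorff_outer])
       (rule hausdorff_outer_separated)
  then show ?thesis
    using assms sets.space_closed[of borel]
    by (intro emeasure_measure_of[OF hausdorff_measure_def]) (auto simp: measure_space_def)
qed

text \<open>Each covering set is cut down to A before it is mapped, since f contracts distances on A
  only; the images have no larger diameters.\<close>

lemma hausdorff_outer_image_le:
  fixes f :: "'a::metric_space \<Rightarrow> 'b::metric_space"
  assumes lip: "\<And>x y. x \<in> A \<Longrightarrow> y \<in> A \<Longrightarrow> dist (f x) (f y) \<le> dist x y"
  shows "hausdorff_outer k (f ` A) \<le> hausdorff_outer k A"
proof (rule hausdorff_outer_leI)
  fix \<delta> :: real assume "0 < \<delta>"
  have "hausdorff_content k \<delta> (f ` A) \<le> hausdorff_content k \<delta> A"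
    unfolding hausdorff_content_def[of k \<delta> A]
  proof (rule INF_greatest)
    fix U assume "U \<in> {U :: nat \<Rightarrow> 'a set. A \<subseteq> (\<Union>i. U i) \<and> (\<forall>i. bounded (U i) \<and> diameter (U i) \<le> \<delta>)}"
    then have U: "A \<subseteq> (\<Union>i. U i)" "\<And>i. bounded (U i)" "\<And>i. diameter (U i) \<le> \<delta>" by auto
    have dist: "dist u v \<le> diameter (U i)" if "u \<in> f ` (U i \<inter> A)" "v \<in> f ` (U i \<inter> A)" for i u v
    proof -
      from that obtain x y where "u = f x" "v = f y" "x \<in> U i" "y \<in> U i" "x \<in> A" "y \<in> A" by blast
      then show ?thesis using order_trans[OF lip diameter_bounded_bound[OF U(2)]] by blast
    qed
    have bd: "bounded (f ` (U i \<inter> A))" for i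
      unfolding bounded_two_points using dist by blast
    have dia: "diameter (f ` (U i \<inter> A)) \<le> diameter (U i)" for i
      using dist diameter_ge_0[OF U(2)] by (intro diameter_le_dist)
    have "hausdorff_content k \<delta> (f ` A) \<le> (\<Sum>i. hausdorff_size k (f ` (U i \<inter> A)))"
      using U(1) by (intro hausdorff_content_le bd order_trans[OF dia U(3)]) blast
    also have "\<dots> \<le> (\<Sum>i. hausdorff_size k (U i))"
    proof (intro suminf_le summableI)
      fix i
      have "unit_ball_vol (real k) * (diameter (f ` (U i \<inter> A)) / 2) ^ k \<le> unit_ball_vol (real k) * (diameter (U i) / 2) ^ k"
        using dia diameter_ge_0[OF bd[of i]] by (intro mult_left_mono power_mono divide_right_mono) auto
      then show "hausdorff_size k (f ` (U i \<inter> A)) \<le> hausdorff_size k (U i)"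
        by (auto simp: hausdorff_size_def intro: ennreal_leI)
    qed
    finally show "hausdorff_content k \<delta> (f ` A) \<le> (\<Sum>i. hausdorff_size k (U i))" .
  qed
  then show "hausdorff_content k \<delta> (f ` A) \<le> hausdorff_outer k A"
    using hausdorff_content_le_outer[OF \<open>0 < \<delta>\<close>] order_trans by blast
qed

text \<open>Both f on A and its inverse on the image are contractions.\<close>

lemma hausdorff_outer_isometry:
  fixes f :: "'a::metric_space \<Rightarrow> 'b::metric_space"
  assumes iso: "\<And>x y. x \<in> A \<Longrightarrow> y \<in> A \<Longrightarrow> dist (f x) (f y) = dist x y"
  shows "hausdorff_outer k (f ` A) = hausdorff_outer k A"
proof (rule antisym)
  have inj: "inj_on f A" by (rule inj_onI) (metis iso dist_eq_0_iff)
  have "hausdorff_outer k (inv_into A f ` f ` A) \<le> hausdorff_outer k (f ` A)"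
    using inj by (intro hausdorff_outer_image_le) (auto simp: iso)
  then show "hausdorff_outer k A \<le> hausdorff_outer k (f ` A)"
    using inj by (simp add: image_image)
qed (rule hausdorff_outer_image_le, simp add: iso)

lemma hausdorff_set_integral_isometry:
  fixes f :: "'a::metric_space \<Rightarrow> 'b::metric_space"
    and g :: "'b \<Rightarrow> 'c::{banach, second_countable_topology}"
  assumes iso: "\<And>x y. x \<in> A \<Longrightarrow> y \<in> A \<Longrightarrow> dist (f x) (f y) = dist x y"
    and A: "A \<in> sets borel" and fA: "f ` A \<in> sets borel"
    and g: "g \<in> borel_measurable borel"
  shows "(LINT x : f ` A | hausdorff_measure k. g x) = (LINT x : A | hausdorff_measure k. g (f x))"
proof -
  let ?MA = "restrict_space (hausdorff_measure k) A"
  let ?MB = "restrict_space (hausdorff_measure k) (f ` A)"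
  have inj: "inj_on f A" by (rule inj_onI) (metis iso dist_eq_0_iff)
  have "continuous_on A f"
    using iso by (auto simp: continuous_on_iff)
  then have "f \<in> borel_measurable (restrict_space borel A)"
    by (rule borel_measurable_continuous_on_restrict)
  moreover have eqA: "measurable ?MA N = measurable (restrict_space borel A) N" for N :: "'z measure"
    by (intro measurable_cong_sets sets_restrict_space_cong) auto
  ultimately have f: "f \<in> measurable ?MA borel" by simp
  have fAB: "f \<in> measurable ?MA ?MB"
    by (rule measurable_restrict_space2)
      (use f in \<open>auto simp: space_restrict_space measurable_cong_sets[of ?MA ?MA "hausdorff_measure k" borel]\<close>)
  \<comment> \<open>The isometry carries one restricted measure to the other; the integral formula
    is then the change of variables for \<open>distr\<close>.\<close>
  have eq: "distr ?MA ?MB f = ?MB"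
  proof (rule measure_eqI)
    fix X assume "X \<in> sets (distr ?MA ?MB f)"
    then have X: "X \<in> sets ?MB" by simp
    then have Xb: "X \<in> sets borel" "X \<subseteq> f ` A" using fA by (auto simp: sets_restrict_space_iff)
    have "f -` X \<inter> A \<in> sets ?MA" using measurable_sets[OF fAB X] by (simp add: space_restrict_space)
    then have pre: "f -` X \<inter> A \<in> sets borel" using A by (auto simp: sets_restrict_space_iff)
    have im: "f ` (f -` X \<inter> A) = X" using Xb(2) by auto
    have "emeasure (distr ?MA ?MB f) X = emeasure ?MA (f -` X \<inter> A)"
      using X fAB by (subst emeasure_distr) (auto simp: space_restrict_space)
    also have "\<dots> = hausdorff_outer k (f -` X \<inter> A)"
      using A pre by (subst emeasure_restrict_space) (auto simp: emeasure_hausdorff_measure)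
    also have "\<dots> = hausdorff_outer k X"
      using hausdorff_outer_isometry[of "f -` X \<inter> A" f k] iso by (simp add: im)
    also have "\<dots> = emeasure ?MB X"
      using fA Xb by (subst emeasure_restrict_space) (auto simp: emeasure_hausdorff_measure)
    finally show "emeasure (distr ?MA ?MB f) X = emeasure ?MB X" .
  qed simp
  have gB: "g \<in> borel_measurable ?MB"
    using g by (intro measurable_restrict_space1) (simp cong: measurable_cong_sets)
  have "(LINT x : f ` A | hausdorff_measure k. g x) = (LINT x | ?MB. g x)"
    using fA by (simp add: set_lebesgue_integral_def integral_restrict_space)
  also have "\<dots> = (LINT x | ?MA. g (f x))"
    by (subst eq[symmetric]) (rule integral_distr[OF fAB gB])
  also have "\<dots> = (LINT x : A | hausdorff_measure k. g (f x))"
    using A by (simp add: set_lebesgue_integral_def integral_restrict_space)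
  finally show ?thesis .
qed

section \<open>The Hausdorff measure of the unit sphere\<close>

lemma hausdorff_content_finite_cover:
  assumes "finite P" "A \<subseteq> (\<Union>p\<in>P. V p)" "\<And>p. p \<in> P \<Longrightarrow> bounded (V p)"
    "\<And>p. p \<in> P \<Longrightarrow> diameter (V p) \<le> \<delta>" "0 \<le> \<delta>"
  shows "hausdorff_content k \<delta> A \<le> (\<Sum>p\<in>P. hausdorff_size k (V p))"
proof -
  obtain h where h: "bij_betw h {..<card P} P"
    using ex_bij_betw_nat_finite[OF assms(1)] by (auto simp: atLeast0LessThan)
  have hP: "h i \<in> P" if "i < card P" for i using h that by (auto simp: bij_betw_def)
  \<comment> \<open>Padding with empty sets is free for every k, including k = 0, by the case
    distinction in \<open>hausdorff_size\<close>.\<close>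
  let ?U = "\<lambda>i. if i < card P then V (h i) else {}"
  have "hausdorff_content k \<delta> A \<le> (\<Sum>i. hausdorff_size k (?U i))"
  proof (rule hausdorff_content_le)
    show "A \<subseteq> (\<Union>i. ?U i)"
    proof
      fix x assume "x \<in> A"
      then obtain p where "p \<in> P" "x \<in> V p" using assms(2) by blast
      moreover from \<open>p \<in> P\<close> obtain i where "i < card P" "p = h i" using h by (auto simp: bij_betw_def)
      ultimately have "x \<in> ?U i" by simp
      then show "x \<in> (\<Union>i. ?U i)" by (rule UN_I[OF UNIV_I])
    qed
  qed (use assms hP in auto)
  also have "\<dots> = (\<Sum>i<card P. hausdorff_size k (?U i))"
    by (rule suminf_finite) auto
  also have "\<dots> = (\<Sum>p\<in>P. hausdorff_size k (V p))"
    using sum.reindex_bij_betw[OF h, of "\<lambda>p. hausdorff_size k (V p)"] by simp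
  finally show ?thesis .
qed

text \<open>Makes the volume of an annulus linear in its width. The bound 2 leaves room for the
  outer radius 1 + eps/2.\<close>

lemma power_diff_le:
  fixes a b :: real
  assumes "0 \<le> b" "b \<le> a" "a \<le> 2"
  shows "a ^ n - b ^ n \<le> real n * 2 ^ n * (a - b)"
proof (induction n)
  case (Suc n)
  have "a ^ Suc n - b ^ Suc n = a * (a ^ n - b ^ n) + b ^ n * (a - b)"
    by (simp add: algebra_simps)
  also have "\<dots> \<le> 2 * (real n * 2 ^ n * (a - b)) + 2 ^ n * (a - b)"
    using assms Suc by (intro add_mono mult_mono mult_right_mono power_mono) (auto simp: power_mono)
  also have "\<dots> \<le> real (Suc n) * 2 ^ Suc n * (a - b)"
    using assms by (simp add: algebra_simps)
  finally show ?case .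
qed simp

text \<open>The balls of radius \<open>\<epsilon> / 2\<close> around the points of \<open>P\<close> are disjoint and lie in an annulus of width \<open>\<epsilon>\<close>.\<close>
lemma card_separated_sphere_le:
  fixes P :: "'a::euclidean_space set"
  assumes P: "P \<subseteq> sphere 0 1" "finite P"
    and sep: "\<And>p q. p \<in> P \<Longrightarrow> q \<in> P \<Longrightarrow> p \<noteq> q \<Longrightarrow> \<epsilon> \<le> dist p q"
    and \<epsilon>: "0 < \<epsilon>" "\<epsilon> \<le> 1" and d: "DIM('a) = Suc k"
  shows "real (card P) * \<epsilon> ^ k \<le> real (Suc k) * 4 ^ Suc k"
proof -
  let ?c = "unit_ball_vol (real (Suc k))"
  let ?R = "ball (0::'a) (1 + \<epsilon> / 2) - ball 0 (1 - \<epsilon> / 2)"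
  have disj: "disjoint_family_on (\<lambda>p. ball p (\<epsilon> / 2)) P"
    unfolding disjoint_family_on_def
  proof (intro ballI impI)
    fix p q assume pq: "p \<in> P" "q \<in> P" "p \<noteq> q"
    show "ball p (\<epsilon> / 2) \<inter> ball q (\<epsilon> / 2) = {}"
      using sep[OF pq] by (intro disjoint_ballI) simp
  qed
  have "real (card P) * (?c * (\<epsilon> / 2) ^ Suc k) = (\<Sum>p\<in>P. measure lborel (ball p (\<epsilon> / 2)))"
    using \<epsilon> d by (simp add: content_ball)
  also have "\<dots> = measure lborel (\<Union>p\<in>P. ball p (\<epsilon> / 2))"
    using P(2) disj emeasure_lborel_ball_finite
    by (intro measure_finite_Union[symmetric]) (auto dest: less_imp_neq)
  also have "\<dots> \<le> measure lborel ?R"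
  proof (rule measure_mono_fmeasurable)
    show "(\<Union>p\<in>P. ball p (\<epsilon> / 2)) \<subseteq> ?R"
    proof
      fix x assume "x \<in> (\<Union>p\<in>P. ball p (\<epsilon> / 2))"
      then obtain p where "p \<in> P" "dist p x < \<epsilon> / 2" by auto
      moreover from \<open>p \<in> P\<close> have "norm p = 1" using P(1) by auto
      ultimately show "x \<in> ?R"
        using norm_triangle_ineq2[of x p] norm_triangle_ineq2[of p x] by (auto simp: dist_norm norm_minus_commute)
    qed
    show "(\<Union>p\<in>P. ball p (\<epsilon> / 2)) \<in> sets lborel" by (auto intro: borel_open)
    show "?R \<in> fmeasurable lborel"
      by (rule fmeasurableI[OF _ le_less_trans[OF emeasure_mono[of _ "ball 0 (1 + \<epsilon> / 2)"]]])
         (use emeasure_lborel_ball_finite in auto)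
  qed
  also have "\<dots> = measure lborel (ball (0::'a) (1 + \<epsilon> / 2)) - measure lborel (ball (0::'a) (1 - \<epsilon> / 2))"
    using \<epsilon> emeasure_lborel_ball_finite by (intro measure_Diff) (auto dest: less_imp_neq)
  also have "\<dots> = ?c * ((1 + \<epsilon> / 2) ^ Suc k - (1 - \<epsilon> / 2) ^ Suc k)"
    using \<epsilon> d by (simp add: content_ball right_diff_distrib)
  also have "\<dots> \<le> ?c * (real (Suc k) * 2 ^ Suc k * ((1 + \<epsilon> / 2) - (1 - \<epsilon> / 2)))"
    using \<epsilon> by (intro mult_left_mono power_diff_le) auto
  finally have "?c * (real (card P) * (\<epsilon> / 2) ^ Suc k) \<le> ?c * (real (Suc k) * 2 ^ Suc k * \<epsilon>)"
    by (simp add: algebra_simps)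
  then have "real (card P) * (\<epsilon> / 2) ^ Suc k \<le> real (Suc k) * 2 ^ Suc k * \<epsilon>"
    by (subst (asm) mult_le_cancel_left_pos) (auto intro: unit_ball_vol_pos)
  \<comment> \<open>One of the k + 1 factors eps cancels against the width of the annulus, which
    leaves the exponent k of the sphere's dimension.\<close>
  then have "\<epsilon> * (real (card P) * \<epsilon> ^ k) \<le> \<epsilon> * (real (Suc k) * (2 ^ Suc k * 2 ^ Suc k))"
    by (simp add: power_divide field_simps)
  then have "real (card P) * \<epsilon> ^ k \<le> real (Suc k) * (2 ^ Suc k * 2 ^ Suc k)"
    using \<epsilon> by simp
  then show ?thesis by (simp only: power_mult_distrib[symmetric]) simp
qed

text \<open>A largest eps-separated set of points is an eps-net. By the packing bound it has at most
  const/eps^k points, so the total size of the balls around them is bounded independently of the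
  scale.\<close>

lemma hausdorff_outer_sphere_finite:
  assumes d: "DIM('a::euclidean_space) = Suc k"
  shows "hausdorff_outer k (sphere (0::'a) 1) < top"
proof -
  let ?C = "unit_ball_vol (real k) * (real (Suc k) * 4 ^ Suc k)"
  have "hausdorff_outer k (sphere (0::'a) 1) \<le> ennreal ?C"
  proof (rule hausdorff_outer_leI)
    fix \<delta> :: real assume "0 < \<delta>"
    \<comment> \<open>Closed balls of radius eps have diameter 2 eps \<le> \<delta>; the packing
      bound asks for eps \<le> 1.\<close>
    define \<epsilon> where "\<epsilon> = min (\<delta> / 2) 1"
    have \<epsilon>: "0 < \<epsilon>" "\<epsilon> \<le> 1" "2 * \<epsilon> \<le> \<delta>" using \<open>0 < \<delta>\<close> by (auto simp: \<epsilon>_def)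
    \<comment> \<open>The cardinalities of separated sets are bounded, so a greatest one exists; an
      uncovered point could be added to the set attaining it.\<close>
    define S where "S n \<longleftrightarrow> (\<exists>P. P \<subseteq> sphere (0::'a) 1 \<and> finite P \<and>
        (\<forall>p\<in>P. \<forall>q\<in>P. p \<noteq> q \<longrightarrow> \<epsilon> \<le> dist p q) \<and> card P = n)" for n
    have "n \<le> nat \<lceil>real (Suc k) * 4 ^ Suc k / \<epsilon> ^ k\<rceil>" if "S n" for n
    proof -
      from that obtain P where P: "P \<subseteq> sphere (0::'a) 1" "finite P"
        "\<And>p q. p \<in> P \<Longrightarrow> q \<in> P \<Longrightarrow> p \<noteq> q \<Longrightarrow> \<epsilon> \<le> dist p q" "card P = n"
        by (auto simp: S_def)
      have "real n * \<epsilon> ^ k \<le> real (Suc k) * 4 ^ Suc k"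
        using card_separated_sphere_le[OF P(1-3) \<epsilon>(1,2) d] P(4) by simp
      then have "real n \<le> real (Suc k) * 4 ^ Suc k / \<epsilon> ^ k" using \<epsilon> by (simp add: pos_le_divide_eq)
      then show ?thesis by linarith
    qed
    moreover have "S 0" unfolding S_def by (rule exI[of _ "{}"]) simp
    ultimately obtain n where n: "S n" "\<And>m. S m \<Longrightarrow> m \<le> n"
      using Nat.ex_has_greatest_nat[of S 0 "nat \<lceil>real (Suc k) * 4 ^ Suc k / \<epsilon> ^ k\<rceil>"] by blast
    from n(1) obtain P where P: "P \<subseteq> sphere (0::'a) 1" "finite P"
        "\<And>p q. p \<in> P \<Longrightarrow> q \<in> P \<Longrightarrow> p \<noteq> q \<Longrightarrow> \<epsilon> \<le> dist p q" "card P = n"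
      by (auto simp: S_def)
    have cover: "sphere (0::'a) 1 \<subseteq> (\<Union>p\<in>P. cball p \<epsilon>)"
    proof (rule ccontr)
      assume "\<not> sphere (0::'a) 1 \<subseteq> (\<Union>p\<in>P. cball p \<epsilon>)"
      then obtain x where x: "x \<in> sphere (0::'a) 1" "\<And>p. p \<in> P \<Longrightarrow> \<epsilon> < dist p x"
        by (force simp: not_le)
      then have "x \<notin> P" using \<epsilon> by force
      have "S (Suc n)" unfolding S_def
        using P x \<open>x \<notin> P\<close> by (intro exI[of _ "insert x P"]) (auto simp: dist_commute less_imp_le)
      then show False using n(2)[of "Suc n"] by simp
    qed
    have "hausdorff_content k \<delta> (sphere (0::'a) 1) \<le> (\<Sum>p\<in>P. hausdorff_size k (cball p \<epsilon>))"
      using P(2) cover \<epsilon> by (intro hausdorff_content_finite_cover) (auto simp: diameter_cball)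
    also have "\<dots> = ennreal (real (card P) * (unit_ball_vol (real k) * \<epsilon> ^ k))"
      using \<epsilon> by (simp add: hausdorff_size_def diameter_cball ennreal_of_nat_eq_real_of_nat ennreal_mult)
    also have "real (card P) * (unit_ball_vol (real k) * \<epsilon> ^ k) = unit_ball_vol (real k) * (real (card P) * \<epsilon> ^ k)"
      by simp
    also have "ennreal \<dots> \<le> ennreal ?C"
      using card_separated_sphere_le[OF P(1-3) \<epsilon>(1,2) d] by (intro ennreal_leI mult_left_mono) auto
    finally show "hausdorff_content k \<delta> (sphere (0::'a) 1) \<le> ennreal ?C" .
  qed
  then show ?thesis by (rule le_less_trans) simp
qed

text \<open>Moving y along the axis b reaches the upper hemisphere. Both coordinates along b lie in
  [-1, 1], hence the bound 2.\<close>

lemma unit_ball_subset_sphere_prism: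
  fixes b :: "'a::euclidean_space"
  assumes b: "b \<in> Basis" and y: "y \<in> ball 0 1"
  obtains s where "norm s = 1" "\<bar>s \<bullet> b - y \<bullet> b\<bar> \<le> 2" "\<And>j. j \<in> Basis \<Longrightarrow> j \<noteq> b \<Longrightarrow> s \<bullet> j = y \<bullet> j"
proof
  define p where "p = y - (y \<bullet> b) *\<^sub>R b"
  define r where "r = sqrt (1 - (norm p)\<^sup>2)"
  have bb: "b \<bullet> b = 1" using b by simp
  have "p \<bullet> b = 0" by (simp add: p_def inner_diff_left bb)
  then have pb: "p \<bullet> b = 0" "b \<bullet> p = 0" by (simp_all add: inner_commute)
  have "(norm p)\<^sup>2 + (y \<bullet> b)\<^sup>2 = (norm y)\<^sup>2"
    unfolding p_def power2_norm_eq_inner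
    by (simp add: inner_diff_left inner_diff_right bb inner_commute power2_eq_square)
  moreover have "(norm y)\<^sup>2 \<le> 1" using y by (simp add: power_le_one)
  ultimately have np: "(norm p)\<^sup>2 \<le> 1" by (smt (verit) zero_le_power2)
  have "(norm (p + r *\<^sub>R b))\<^sup>2 = (norm p)\<^sup>2 + r\<^sup>2"
    unfolding power2_norm_eq_inner
    by (simp add: inner_add_left inner_add_right bb pb inner_commute power2_eq_square)
  also have "\<dots> = 1" using np by (simp add: r_def)
  finally show "norm (p + r *\<^sub>R b) = 1" by (simp add: power2_eq_1_iff) (smt (verit) norm_ge_zero)
  have "0 \<le> r" "r \<le> 1" using np by (auto simp: r_def)
  moreover have "\<bar>y \<bullet> b\<bar> \<le> 1" using Basis_le_norm[OF b, of y] y by simp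
  ultimately show "\<bar>(p + r *\<^sub>R b) \<bullet> b - y \<bullet> b\<bar> \<le> 2" by (simp add: inner_add_left pb bb)
  show "(p + r *\<^sub>R b) \<bullet> j = y \<bullet> j" if "j \<in> Basis" "j \<noteq> b" for j
    using that b by (simp add: p_def inner_add_left inner_diff_left inner_Basis)
qed

text \<open>
  Thickening the sets of a cover of the sphere along one coordinate axis gives boxes that cover the
  unit ball, and the volume of each box is a constant times the size of the covering set.
\<close>
lemma hausdorff_outer_sphere_pos:
  assumes d: "DIM('a::euclidean_space) = Suc k"
  shows "0 < hausdorff_outer k (sphere (0::'a) 1)"
proof -
  obtain b :: 'a where b: "b \<in> Basis" using nonempty_Basis by blast
  \<comment> \<open>The ratio of the box volume 6 (2 diam)^k to the size
    \<open>unit_ball_vol k * (diam / 2) ^ k\<close> of the covering set.\<close>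
  define C where "C = 6 * 4 ^ k / unit_ball_vol (real k)"
  have C: "0 < C" by (simp add: C_def)
  \<comment> \<open>One scale suffices, as the content at any scale bounds the outer measure from
    below; scale 1 keeps all diameters at most 1.\<close>
  have "emeasure lborel (ball (0::'a) 1) / ennreal C \<le> hausdorff_content k 1 (sphere (0::'a) 1)"
    unfolding hausdorff_content_def
  proof (rule INF_greatest)
    fix U assume "U \<in> {U :: nat \<Rightarrow> 'a set. sphere 0 1 \<subseteq> (\<Union>i. U i) \<and> (\<forall>i. bounded (U i) \<and> diameter (U i) \<le> 1)}"
    then have U: "sphere 0 1 \<subseteq> (\<Union>i. U i)" "\<And>i. bounded (U i)" "\<And>i. diameter (U i) \<le> 1" by auto
    define x where "x i = (SOME x. x \<in> U i)" for i
    have x: "x i \<in> U i" if "U i \<noteq> {}" for i using that by (auto simp: x_def some_in_eq)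
    \<comment> \<open>The half-width 3 along b is 2 for the shift from the sphere to the ball plus 1
      for the diameter of the covering set.\<close>
    define h where "h i = (\<Sum>j\<in>Basis. (if j = b then 3 else diameter (U i)) *\<^sub>R j)" for i
    have h: "h i \<bullet> j = (if j = b then 3 else diameter (U i))" if "j \<in> Basis" for i j
      using that by (simp add: h_def)
    define Q where "Q i = (if U i = {} then {} else cbox (x i - h i) (x i + h i))" for i
    have Q: "emeasure lborel (Q i) \<le> ennreal C * hausdorff_size k (U i)" for i
    proof (cases "U i = {}")
      case False
      have "emeasure lborel (Q i) = ennreal (\<Prod>j\<in>Basis. 2 * (h i \<bullet> j))"
        using False diameter_ge_0[OF U(2)[of i]]
        by (simp add: Q_def emeasure_lborel_cbox_eq inner_diff_left inner_add_left h) 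
      also have "(\<Prod>j\<in>Basis. 2 * (h i \<bullet> j)) = 6 * (\<Prod>j\<in>Basis - {b}. 2 * (h i \<bullet> j))"
        using b by (subst prod.remove[of _ b]) (auto simp: h)
      also have "(\<Prod>j\<in>Basis - {b}. 2 * (h i \<bullet> j)) = (\<Prod>j\<in>Basis - {b}. 2 * diameter (U i))"
        by (intro prod.cong) (auto simp: h)
      also have "\<dots> = (2 * diameter (U i)) ^ k" using b d by simp
      also have "6 * (2 * diameter (U i)) ^ k = C * (unit_ball_vol (real k) * (diameter (U i) / 2) ^ k)"
      proof -
        have "(2 * diameter (U i)) ^ k = (4 * (diameter (U i) / 2)) ^ k" by simp
        also have "\<dots> = 4 ^ k * (diameter (U i) / 2) ^ k" by (rule power_mult_distrib)
        moreover have "unit_ball_vol (real k) \<noteq> 0" using unit_ball_vol_pos[of "real k"] by linarith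
        ultimately show ?thesis by (simp add: C_def)
      qed
      also have "ennreal \<dots> = ennreal C * hausdorff_size k (U i)"
        using False C diameter_ge_0[OF U(2)[of i]] by (simp add: hausdorff_size_def ennreal_mult)
      finally show ?thesis by simp
    qed (simp add: Q_def)
    have "ball 0 1 \<subseteq> (\<Union>i. Q i)"
    proof
      fix y :: 'a assume "y \<in> ball 0 1"
      then obtain s where s: "norm s = 1" "\<bar>s \<bullet> b - y \<bullet> b\<bar> \<le> 2" "\<And>j. j \<in> Basis \<Longrightarrow> j \<noteq> b \<Longrightarrow> s \<bullet> j = y \<bullet> j"
        using unit_ball_subset_sphere_prism[OF b] by blast
      then obtain i where i: "s \<in> U i" using U(1) by force
      have "\<bar>x i \<bullet> j - y \<bullet> j\<bar> \<le> h i \<bullet> j" if j: "j \<in> Basis" for j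
      proof -
        have "\<bar>(x i - s) \<bullet> j\<bar> \<le> dist (x i) s" unfolding dist_norm by (rule Basis_le_norm[OF j])
        also have "\<dots> \<le> diameter (U i)" using i x by (intro diameter_bounded_bound U(2)) auto
        finally have "\<bar>x i \<bullet> j - s \<bullet> j\<bar> \<le> diameter (U i)" by (simp add: inner_diff_left)
        then show ?thesis using s(2) s(3)[OF j] U(3)[of i] j by (cases "j = b") (auto simp: h)
      qed
      then have "y \<in> cbox (x i - h i) (x i + h i)"
        by (auto simp: mem_box inner_diff_left inner_add_left abs_le_iff algebra_simps)
      then have "y \<in> Q i" using i by (auto simp: Q_def)
      then show "y \<in> (\<Union>i. Q i)" by blast
    qed
    then have "emeasure lborel (ball (0::'a) 1) \<le> emeasure lborel (\<Union>i. Q i)"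
      by (intro emeasure_mono) (auto simp: Q_def)
    also have "\<dots> \<le> (\<Sum>i. emeasure lborel (Q i))"
      by (intro emeasure_subadditive_countably) (auto simp: Q_def)
    also have "\<dots> \<le> (\<Sum>i. ennreal C * hausdorff_size k (U i))"
      by (intro suminf_le Q summableI)
    also have "\<dots> = (\<Sum>i. hausdorff_size k (U i)) * ennreal C" by (simp add: mult.commute)
    finally show "emeasure lborel (ball (0::'a) 1) / ennreal C \<le> (\<Sum>i. hausdorff_size k (U i))"
      using C by (intro divide_le_posI_ennreal) (auto simp: mult.commute)
  qed
  moreover have "0 < emeasure lborel (ball (0::'a) 1) / ennreal C"
    by (simp add: ennreal_zero_less_divide emeasure_ball)
  ultimately show ?thesis
    using hausdorff_content_le_outer[of 1 k "sphere (0::'a) 1"] by (meson less_le_trans zero_less_one)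
qed

section \<open>Moments of the unit sphere of a subspace\<close>

definition subspace_sphere :: "'a::euclidean_space set \<Rightarrow> 'a set" where
  "subspace_sphere T = {e \<in> T. norm e = 1}"

text \<open>The sphere is the whole space of this measure, so identities that hold only for unit
  vectors of T may be used under the integral.\<close>

definition subspace_sphere_measure :: "'a::euclidean_space set \<Rightarrow> 'a measure" where
  "subspace_sphere_measure T = restrict_space (hausdorff_measure (dim T - 1)) (subspace_sphere T)"

lemma subspace_sphere_borel [measurable]:
  assumes "subspace T"
  shows "subspace_sphere T \<in> sets borel"
proof -
  have "subspace_sphere T = T \<inter> sphere 0 1" by (auto simp: subspace_sphere_def)
  then show ?thesis using closed_subspace[OF assms] by (simp add: borel_closed closed_Int)
qed

lemma space_subspace_sphere_measure [simp]: "space (subspace_sphere_measure T) = subspace_sphere T"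
  by (simp add: subspace_sphere_measure_def space_restrict_space)

text \<open>The two bounds for the sphere come from Lebesgue measure of a full Euclidean space; a
  linear isometry of that space onto T transfers them.\<close>

lemma hausdorff_outer_subspace_sphere:
  fixes T :: "'a::euclidean_space set"
  assumes T: "subspace T" "dim T = DIM('b::euclidean_space)"
  shows "hausdorff_outer k (subspace_sphere T) = hausdorff_outer k (sphere (0::'b) 1)"
proof -
  obtain f :: "'b \<Rightarrow> 'a" where f: "linear f" "f ` UNIV = T" "\<And>x. norm (f x) = norm x"
    using isometry_subspaces[of "UNIV :: 'b set" T] T by auto
  have "subspace_sphere T = f ` sphere 0 1"
    using f(2,3) by (auto simp: subspace_sphere_def image_iff)
  moreover have "dist (f x) (f y) = dist x y" for x y
    using f(3)[of "x - y"] by (simp add: dist_norm linear_diff[OF f(1)])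
  ultimately show ?thesis by (simp add: hausdorff_outer_isometry)
qed

lemma continuous_imp_integrable_subspace_sphere:
  fixes g :: "'a::euclidean_space \<Rightarrow> 'c::{banach, second_countable_topology}"
  assumes T: "subspace T" and fin: "hausdorff_outer (dim T - 1) (subspace_sphere T) < top"
    and g: "continuous_on UNIV g"
  shows "integrable (subspace_sphere_measure T) g"
proof -
  have "subspace_sphere T = T \<inter> sphere 0 1" by (auto simp: subspace_sphere_def)
  then have "compact (subspace_sphere T)" using closed_subspace[OF T] by (simp add: closed_Int_compact)
  then have "bounded (g ` subspace_sphere T)"
    using g by (intro compact_imp_bounded compact_continuous_image) (auto intro: continuous_on_subset)
  then obtain B where "\<And>x. x \<in> subspace_sphere T \<Longrightarrow> norm (g x) \<le> B" by (auto simp: bounded_iff)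
  then have "integrable (hausdorff_measure (dim T - 1)) (\<lambda>x. indicator (subspace_sphere T) x *\<^sub>R g x)"
    using T fin borel_measurable_continuous_onI[OF g]
    by (intro integrableI_bounded_set_indicator[where B = B])
       (auto simp: emeasure_hausdorff_measure cong: measurable_cong_sets)
  then show ?thesis
    using T by (simp add: subspace_sphere_measure_def integrable_restrict_space)
qed

lemma integral_subspace_sphere_measure:
  fixes g :: "'a::euclidean_space \<Rightarrow> 'c::{banach, second_countable_topology}"
  assumes "subspace T"
  shows "integral\<^sup>L (subspace_sphere_measure T) g = (LINT e : subspace_sphere T | hausdorff_measure (dim T - 1). g e)"
  using assms by (simp add: subspace_sphere_measure_def set_lebesgue_integral_def integral_restrict_space)

text \<open>The reflection in the hyperplane orthogonal to \<open>x - y\<close> swaps \<open>x\<close> and \<open>y\<close>.\<close>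
lemma quartic_integral_eq:
  fixes T :: "'a::euclidean_space set"
  assumes T: "subspace T" and xy: "x \<in> T" "y \<in> T" "norm x = norm y"
  shows "(LINT e|subspace_sphere_measure T. (e \<bullet> x) ^ 4) = (LINT e|subspace_sphere_measure T. (e \<bullet> y) ^ 4)"
proof -
  define w where "w = x - y"
  \<comment> \<open>If w = 0, this is the identity.\<close>
  define r where "r e = e - (2 * (e \<bullet> w) / (w \<bullet> w)) *\<^sub>R w" for e
  have w: "w \<in> T" using xy T by (simp add: w_def subspace_diff)
  have "r e \<bullet> r e = e \<bullet> e" for e
    by (cases "w = 0") (auto simp: r_def inner_diff_left inner_diff_right inner_commute)
  then have nr: "norm (r e) = norm e" for e by (simp add: norm_eq_sqrt_inner)
  have "linear r"
    by (rule linearI) (simp_all add: r_def inner_add_left algebra_simps add_divide_distrib)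
  have dr: "dist (r e) (r e') = dist e e'" for e e'
    using nr[of "e - e'"] by (simp add: dist_norm linear_diff[OF \<open>linear r\<close>])
  have rr: "r (r e) = e" for e
    by (cases "w = 0") (auto simp: r_def inner_diff_left)
  have rT: "r e \<in> T" if "e \<in> T" for e
    using that w T by (simp add: r_def subspace_diff subspace_scale)
  have img: "r ` subspace_sphere T = subspace_sphere T"
  proof
    show "subspace_sphere T \<subseteq> r ` subspace_sphere T"
      using rr by (auto simp: subspace_sphere_def nr rT intro!: image_eqI[of _ r "r _"])
  qed (auto simp: subspace_sphere_def nr rT)
  have xx: "x \<bullet> x = y \<bullet> y" using xy(3) by (simp add: norm_eq_sqrt_inner)
  have rx: "r e \<bullet> x = e \<bullet> y" for e
  proof (cases "w = 0")
    case False
    \<comment> \<open>Equal norms make the coefficient of w in r e equal to (e . w) / (w . x), so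
      that r e . x = e . x - e . w = e . y.\<close>
    have "w \<bullet> w = 2 * (w \<bullet> x)" using xx by (simp add: w_def inner_diff_left inner_diff_right inner_commute)
    moreover have "w \<bullet> w \<noteq> 0" using False by simp
    ultimately have "w \<bullet> x \<noteq> 0" by auto
    then have "r e \<bullet> x = e \<bullet> x - e \<bullet> w"
      unfolding r_def \<open>w \<bullet> w = 2 * (w \<bullet> x)\<close> by (simp add: inner_diff_left)
    then show ?thesis by (simp add: w_def inner_diff_right)
  qed (simp add: r_def w_def)
  have "(LINT e : r ` subspace_sphere T | hausdorff_measure (dim T - 1). (e \<bullet> x) ^ 4) =
      (LINT e : subspace_sphere T | hausdorff_measure (dim T - 1). (r e \<bullet> x) ^ 4)"
    using T dr by (intro hausdorff_set_integral_isometry) (auto simp: img)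
  then show ?thesis by (simp add: integral_subspace_sphere_measure[OF T] img rx)
qed

text \<open>Invariance reduces x to a multiple of a fixed z, and homogeneity of degree 4 computes
  the multiple.\<close>

lemma quartic_integral:
  fixes T :: "'a::euclidean_space set"
  assumes T: "subspace T"
  obtains c where "\<And>x. x \<in> T \<Longrightarrow> (LINT e|subspace_sphere_measure T. (e \<bullet> x) ^ 4) = c * (x \<bullet> x)\<^sup>2"
proof (cases "T = {0}")
  case True
  then show ?thesis using that[of 0] by simp
next
  case False
  then obtain z where z: "z \<in> T" "z \<noteq> 0" using subspace_0[OF T] by blast
  let ?Q = "\<lambda>x. LINT e|subspace_sphere_measure T. (e \<bullet> x) ^ 4"
  have "?Q x = ?Q z / (z \<bullet> z)\<^sup>2 * (x \<bullet> x)\<^sup>2" if "x \<in> T" for x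
  proof -
    define t where "t = norm x / norm z"
    have "?Q x = ?Q (t *\<^sub>R z)"
      using that z T by (intro quartic_integral_eq) (auto simp: t_def subspace_scale)
    also have "\<dots> = (LINT e|subspace_sphere_measure T. t ^ 4 * (e \<bullet> z) ^ 4)"
      by (simp add: power_mult_distrib)
    also have "\<dots> = t ^ 4 * ?Q z" by simp
    also have "t ^ 4 = (x \<bullet> x)\<^sup>2 / (z \<bullet> z)\<^sup>2"
      by (simp add: t_def power_divide dot_square_norm flip: power_mult)
    finally show ?thesis by simp
  qed
  then show ?thesis by (rule that)
qed

text \<open>Each fourth power carries the product of its four signs. The monomial abcd has
  coefficient 4! = 24 in each of the 8 powers, whence 192; all other monomials cancel.\<close>

lemma quartic_polarization:
  fixes a b c d :: real
  shows "192 * (a * b * c * d) = (a + b + c + d) ^ 4 - (a + b + c - d) ^ 4 - (a + b - c + d) ^ 4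
    - (a - b + c + d) ^ 4 + (a + b - c - d) ^ 4 + (a - b + c - d) ^ 4 + (a - b - c + d) ^ 4 - (a - b - c - d) ^ 4"
  by algebra

text \<open>The same signed sum for the squared norm squared. Each of the three pairings occurs 8
  times in a term, and there are 8 terms.\<close>

lemma inner_polarization:
  fixes x y u v :: "'a::real_inner"
  defines "q \<equiv> \<lambda>w::'a. (w \<bullet> w)\<^sup>2"
  shows "q (x + y + u + v) - q (x + y + u - v) - q (x + y - u + v) - q (x - y + u + v)
    + q (x + y - u - v) + q (x - y + u - v) + q (x - y - u + v) - q (x - y - u - v) =
    64 * ((x \<bullet> y) * (u \<bullet> v) + (x \<bullet> u) * (y \<bullet> v) + (x \<bullet> v) * (y \<bullet> u))"
  unfolding q_def inner_add_left inner_add_right inner_diff_left inner_diff_right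
    inner_commute[of y x] inner_commute[of u x] inner_commute[of v x] inner_commute[of u y]
    inner_commute[of v y] inner_commute[of v u]
  by algebra

lemma quartic_moments:
  fixes T :: "'a::euclidean_space set"
  assumes T: "subspace T" and fin: "hausdorff_outer (dim T - 1) (subspace_sphere T) < top"
  obtains c where "\<And>x y u v. x \<in> T \<Longrightarrow> y \<in> T \<Longrightarrow> u \<in> T \<Longrightarrow> v \<in> T \<Longrightarrow>
    (LINT e|subspace_sphere_measure T. (e \<bullet> x) * (e \<bullet> y) * (e \<bullet> u) * (e \<bullet> v)) =
      c * ((x \<bullet> y) * (u \<bullet> v) + (x \<bullet> u) * (y \<bullet> v) + (x \<bullet> v) * (y \<bullet> u))"
proof -
  let ?M = "subspace_sphere_measure T"
  obtain c where c: "\<And>x. x \<in> T \<Longrightarrow> (LINT e|?M. (e \<bullet> x) ^ 4) = c * (x \<bullet> x)\<^sup>2"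
    using quartic_integral[OF T] by blast
  have int: "integrable ?M (\<lambda>e. (e \<bullet> x) ^ 4)" for x
    by (intro continuous_imp_integrable_subspace_sphere T fin continuous_intros)
  \<comment> \<open>The quotient 64/192 of the two polarization constants.\<close>
  have scale: "I = c / 3 * P" if "192 * I = c * (64 * P)" for I P
    using that by (simp add: mult.commute)
  show thesis
  proof
    fix x y u v assume xyuv: "x \<in> T" "y \<in> T" "u \<in> T" "v \<in> T"
    have "192 * (LINT e|?M. (e \<bullet> x) * (e \<bullet> y) * (e \<bullet> u) * (e \<bullet> v)) =
        (LINT e|?M. 192 * ((e \<bullet> x) * (e \<bullet> y) * (e \<bullet> u) * (e \<bullet> v)))" by simp
    also have "\<dots> = c * (64 * ((x \<bullet> y) * (u \<bullet> v) + (x \<bullet> u) * (y \<bullet> v) + (x \<bullet> v) * (y \<bullet> u)))"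
      unfolding quartic_polarization inner_polarization[symmetric]
        inner_add_right[symmetric] inner_diff_right[symmetric]
      using xyuv T by (simp add: int c subspace_add subspace_diff right_diff_distrib distrib_left)
    finally show "(LINT e|?M. (e \<bullet> x) * (e \<bullet> y) * (e \<bullet> u) * (e \<bullet> v)) =
      c / 3 * ((x \<bullet> y) * (u \<bullet> v) + (x \<bullet> u) * (y \<bullet> v) + (x \<bullet> v) * (y \<bullet> u))" by (rule scale)
  qed
qed

text \<open>Put d = dim T and let tr be the trace of L on T. The pairings give c (tr (x . y) + 2 Lx
  . y) for the quartic part, symmetry of L merging two of them, and c (d + 2) tr for the integral of
  e . Le. The weight d + 2 cancels the trace, and the mass c d (d + 2) of the sphere eliminates
  c.\<close>

lemma quadratic_form_moment:
  fixes T :: "'a::euclidean_space set"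
  assumes T: "subspace T" and fin: "hausdorff_outer (dim T - 1) (subspace_sphere T) < top"
    and L: "linear L" "\<And>x. x \<in> T \<Longrightarrow> L x \<in> T" "\<And>x y. x \<in> T \<Longrightarrow> y \<in> T \<Longrightarrow> L x \<bullet> y = x \<bullet> L y"
    and xy: "x \<in> T" "y \<in> T"
  shows "real (dim T) * (LINT e|subspace_sphere_measure T. (e \<bullet> L e) * (real (dim T + 2) * ((e \<bullet> x) * (e \<bullet> y)) - x \<bullet> y)) =
    2 * measure (subspace_sphere_measure T) (subspace_sphere T) * (L x \<bullet> y)"
proof -
  let ?M = "subspace_sphere_measure T"
  obtain c where c: "\<And>x y u v. x \<in> T \<Longrightarrow> y \<in> T \<Longrightarrow> u \<in> T \<Longrightarrow> v \<in> T \<Longrightarrow>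
    (LINT e|?M. (e \<bullet> x) * (e \<bullet> y) * (e \<bullet> u) * (e \<bullet> v)) =
      c * ((x \<bullet> y) * (u \<bullet> v) + (x \<bullet> u) * (y \<bullet> v) + (x \<bullet> v) * (y \<bullet> u))"
    using quartic_moments[OF T fin] by blast
  obtain B where B: "B \<subseteq> T" "pairwise orthogonal B" "\<And>b. b \<in> B \<Longrightarrow> norm b = 1"
      "independent B" "card B = dim T" "span B = T"
    using orthonormal_basis_subspace[OF T] by blast
  have finB: "finite B" using B(4) by (rule independent_imp_finite)
  have bT: "b \<in> T" if "b \<in> B" for b using that B(1) by blast
  have bb: "b \<bullet> b = 1" if "b \<in> B" for b using B(3)[OF that] by (simp add: norm_eq_1)
  have expand: "(\<Sum>b\<in>B. (x \<bullet> b) *\<^sub>R b) = x" if "x \<in> T" for x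
    using orthonormal_basis_expand[OF B(2,3) _ finB, of x] that B(6) by blast
  have parseval: "(\<Sum>b\<in>B. (x \<bullet> b) * (y \<bullet> b)) = x \<bullet> y" if "x \<in> T" for x y
    using arg_cong[OF expand[OF that], of "\<lambda>z. y \<bullet> z"] by (simp add: inner_sum_right inner_commute)
  have Lexp: "(\<Sum>b\<in>B. (x \<bullet> b) *\<^sub>R L b) = L x" if "x \<in> T" for x
    using arg_cong[OF expand[OF that], of L] by (simp add: linear_sum[OF L(1)] linear_scale[OF L(1)])
  have quad: "(\<Sum>b\<in>B. (x \<bullet> b) * (L b \<bullet> y)) = L x \<bullet> y" if "x \<in> T" for x y
    using arg_cong[OF Lexp[OF that], of "\<lambda>z. z \<bullet> y"] by (simp add: inner_sum_left)
  have contL: "continuous_on UNIV L" using L(1) by (simp add: linear_continuous_on linear_conv_bounded_linear)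
  note int = continuous_imp_integrable_subspace_sphere[OF T fin]
  have one: "(\<Sum>b\<in>B. (e \<bullet> b) * (e \<bullet> b)) = 1" if "e \<in> subspace_sphere T" for e
    using parseval[of e e] that by (simp add: subspace_sphere_def norm_eq_1)
  \<comment> \<open>Insert 1 = sum of (e . b)^2 over the basis: the pairing b . b contributes d, the
    two mixed pairings 2.\<close>
  have second: "(LINT e|?M. (e \<bullet> u) * (e \<bullet> v)) = c * real (dim T + 2) * (u \<bullet> v)"
    if "u \<in> T" "v \<in> T" for u v
  proof -
    have "(LINT e|?M. (e \<bullet> u) * (e \<bullet> v)) = (LINT e|?M. (\<Sum>b\<in>B. (e \<bullet> b) * (e \<bullet> b) * (e \<bullet> u) * (e \<bullet> v)))"
      by (rule Bochner_Integration.integral_cong) (simp_all add: sum_distrib_right[symmetric] one)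
    also have "\<dots> = (\<Sum>b\<in>B. LINT e|?M. (e \<bullet> b) * (e \<bullet> b) * (e \<bullet> u) * (e \<bullet> v))"
      by (intro Bochner_Integration.integral_sum int continuous_intros)
    also have "\<dots> = (\<Sum>b\<in>B. c * ((u \<bullet> v) + 2 * ((u \<bullet> b) * (v \<bullet> b))))"
    proof (rule sum.cong)
      fix b assume "b \<in> B"
      then show "(LINT e|?M. (e \<bullet> b) * (e \<bullet> b) * (e \<bullet> u) * (e \<bullet> v)) = c * ((u \<bullet> v) + 2 * ((u \<bullet> b) * (v \<bullet> b)))"
        unfolding c[OF bT[OF \<open>b \<in> B\<close>] bT[OF \<open>b \<in> B\<close>] that]
        by (simp add: bb inner_commute[of b u] inner_commute[of b v])
    qed simp
    also have "\<dots> = c * (real (card B) * (u \<bullet> v) + 2 * (\<Sum>b\<in>B. (u \<bullet> b) * (v \<bullet> b)))"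
      by (simp add: sum_distrib_left[symmetric] sum.distrib)
    also have "\<dots> = c * real (dim T + 2) * (u \<bullet> v)"
      by (simp add: parseval that B(5) algebra_simps)
    finally show ?thesis .
  qed
  \<comment> \<open>The same insertion again: each of the d basis vectors contributes c (d +
    2).\<close>
  have total: "measure ?M (subspace_sphere T) = c * real (dim T + 2) * real (dim T)"
  proof -
    have "measure ?M (subspace_sphere T) = (LINT e|?M. 1)" by simp
    also have "\<dots> = (LINT e|?M. (\<Sum>b\<in>B. (e \<bullet> b) * (e \<bullet> b)))"
      by (rule Bochner_Integration.integral_cong) (simp_all add: one)
    also have "\<dots> = (\<Sum>b\<in>B. LINT e|?M. (e \<bullet> b) * (e \<bullet> b))"
      by (intro Bochner_Integration.integral_sum int continuous_intros)
    also have "\<dots> = c * real (dim T + 2) * real (dim T)" by (simp add: second bT bb B(5))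
    finally show ?thesis .
  qed
  define tr where "tr = (\<Sum>b\<in>B. b \<bullet> L b)"
  \<comment> \<open>Expanding one factor e leaves products of linear forms e . b and e . Lb, and the
    moment formulas apply because L maps T into T.\<close>
  have form: "e \<bullet> L e = (\<Sum>b\<in>B. (e \<bullet> b) * (e \<bullet> L b))" if "e \<in> subspace_sphere T" for e
    using quad[of e e] that by (simp add: subspace_sphere_def inner_commute)
  have "(LINT e|?M. (e \<bullet> L e) * ((e \<bullet> x) * (e \<bullet> y))) =
      (LINT e|?M. (\<Sum>b\<in>B. (e \<bullet> b) * (e \<bullet> L b) * (e \<bullet> x) * (e \<bullet> y)))"
    by (rule Bochner_Integration.integral_cong) (simp_all add: form sum_distrib_right mult.assoc)
  also have "\<dots> = (\<Sum>b\<in>B. LINT e|?M. (e \<bullet> b) * (e \<bullet> L b) * (e \<bullet> x) * (e \<bullet> y))"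
    by (intro Bochner_Integration.integral_sum int continuous_intros)
  also have "\<dots> = (\<Sum>b\<in>B. c * ((b \<bullet> L b) * (x \<bullet> y) + (x \<bullet> b) * (L b \<bullet> y) + (y \<bullet> b) * (L b \<bullet> x)))"
  proof (rule sum.cong)
    fix b assume "b \<in> B"
    then show "(LINT e|?M. (e \<bullet> b) * (e \<bullet> L b) * (e \<bullet> x) * (e \<bullet> y)) =
        c * ((b \<bullet> L b) * (x \<bullet> y) + (x \<bullet> b) * (L b \<bullet> y) + (y \<bullet> b) * (L b \<bullet> x))"
      unfolding c[OF bT[OF \<open>b \<in> B\<close>] L(2)[OF bT[OF \<open>b \<in> B\<close>]] xy]
      by (simp add: inner_commute[of b x] inner_commute[of b y])
  qed simp
  also have "\<dots> = c * (tr * (x \<bullet> y) + (\<Sum>b\<in>B. (x \<bullet> b) * (L b \<bullet> y)) + (\<Sum>b\<in>B. (y \<bullet> b) * (L b \<bullet> x)))"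
    by (simp add: sum_distrib_left[symmetric] sum_distrib_right[symmetric] sum.distrib tr_def)
  also have "\<dots> = c * (tr * (x \<bullet> y) + 2 * (L x \<bullet> y))"
    using L(3)[OF xy] unfolding quad[OF xy(1)] quad[OF xy(2)] by (simp add: inner_commute)
  finally have fourth: "(LINT e|?M. (e \<bullet> L e) * ((e \<bullet> x) * (e \<bullet> y))) = c * (tr * (x \<bullet> y) + 2 * (L x \<bullet> y))" .
  have "(LINT e|?M. e \<bullet> L e) = (LINT e|?M. (\<Sum>b\<in>B. (e \<bullet> b) * (e \<bullet> L b)))"
    by (rule Bochner_Integration.integral_cong) (simp_all add: form)
  also have "\<dots> = (\<Sum>b\<in>B. LINT e|?M. (e \<bullet> b) * (e \<bullet> L b))"
    by (intro Bochner_Integration.integral_sum int continuous_intros)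
  also have "\<dots> = c * real (dim T + 2) * tr"
    by (simp add: second bT L(2) tr_def sum_distrib_left)
  finally have trace: "(LINT e|?M. e \<bullet> L e) = c * real (dim T + 2) * tr" .
  have i1: "integrable ?M (\<lambda>e. (e \<bullet> L e) * ((e \<bullet> x) * (e \<bullet> y)))" and i2: "integrable ?M (\<lambda>e. e \<bullet> L e)"
    by (intro int continuous_intros contL)+
  have "(LINT e|?M. (e \<bullet> L e) * (real (dim T + 2) * ((e \<bullet> x) * (e \<bullet> y)) - x \<bullet> y)) =
      (LINT e|?M. real (dim T + 2) * ((e \<bullet> L e) * ((e \<bullet> x) * (e \<bullet> y))) - (x \<bullet> y) * (e \<bullet> L e))"
    by (simp add: algebra_simps)
  also have "\<dots> = real (dim T + 2) * (LINT e|?M. (e \<bullet> L e) * ((e \<bullet> x) * (e \<bullet> y))) - (x \<bullet> y) * (LINT e|?M. e \<bullet> L e)"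
    using i1 i2 by simp
  also have "\<dots> = 2 * (c * real (dim T + 2)) * (L x \<bullet> y)"
    unfolding fourth trace by (simp add: algebra_simps)
  finally show ?thesis by (simp add: total)
qed

section \<open>Symmetry of second derivatives\<close>

text \<open>The mean value theorem in direction u turns the second difference into t times an
  increment of \<open>D _ u\<close>, and differentiability of \<open>D _ u\<close> at x replaces
  this increment by t B v u. The two endpoints of the increment share the error e.\<close>

lemma second_difference_bound:
  fixes f :: "'b::real_normed_vector \<Rightarrow> real"
  assumes r: "0 < r" "\<And>y. dist x y < r \<Longrightarrow> (f has_derivative D y) (at y)"
    and B: "((\<lambda>y. D y u) has_derivative (\<lambda>h. B h u)) (at x)"
    and e: "0 < e"
  obtains d where "0 < d" "\<And>t. 0 < t \<Longrightarrow> t < d \<Longrightarrow>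
    \<bar>f (x + t *\<^sub>R u + t *\<^sub>R v) - f (x + t *\<^sub>R u) - f (x + t *\<^sub>R v) + f x - t\<^sup>2 * B v u\<bar> \<le> e * t\<^sup>2"
proof -
  \<comment> \<open>All points involved lie within t K of x; the summand 1 keeps K positive.\<close>
  define K where "K = 1 + norm u + norm v"
  have K: "0 < K" by (simp add: K_def add_pos_nonneg)
  from B have lin: "bounded_linear (\<lambda>h. B h u)" by (rule has_derivative_bounded_linear)
  have "0 < e / (2 * K)" using e K by simp
  then obtain d where d: "0 < d" "\<And>y. norm (y - x) < d \<Longrightarrow>
      norm (D y u - D x u - B (y - x) u) \<le> e / (2 * K) * norm (y - x)"
    using B unfolding has_derivative_at_alt by blast
  define d' where "d' = min r d / K"
  have "0 < d'" using r(1) d(1) K by (simp add: d'_def)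
  moreover have "\<bar>f (x + t *\<^sub>R u + t *\<^sub>R v) - f (x + t *\<^sub>R u) - f (x + t *\<^sub>R v) + f x - t\<^sup>2 * B v u\<bar> \<le> e * t\<^sup>2"
    if t: "0 < t" "t < d'" for t
  proof -
    have tK: "t * K < r" "t * K < d" using t K by (auto simp: d'_def pos_less_divide_eq)
    have small: "norm (s *\<^sub>R u + c *\<^sub>R v) \<le> t * K" if "0 \<le> s" "s \<le> t" "0 \<le> c" "c \<le> t" for s c
    proof -
      have "norm (s *\<^sub>R u + c *\<^sub>R v) \<le> s * norm u + c * norm v"
        using norm_triangle_ineq[of "s *\<^sub>R u" "c *\<^sub>R v"] that by simp
      also have "\<dots> \<le> t * norm u + t * norm v" using that by (intro add_mono mult_right_mono) auto
      also have "\<dots> \<le> t * K" using t by (simp add: K_def algebra_simps)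
      finally show ?thesis .
    qed
    have dist_add: "dist x (x + s *\<^sub>R u + c *\<^sub>R v) = norm (s *\<^sub>R u + c *\<^sub>R v)" for s c
      by (metis add.assoc add_diff_cancel_left' dist_commute dist_norm)
    define g where "g s = f (x + s *\<^sub>R u + t *\<^sub>R v) - f (x + s *\<^sub>R u)" for s
    have der: "((\<lambda>s. f (x + s *\<^sub>R u + c *\<^sub>R v)) has_derivative (\<lambda>h. D (x + s *\<^sub>R u + c *\<^sub>R v) (h *\<^sub>R u))) (at s)"
      if "0 \<le> s" "s \<le> t" "0 \<le> c" "c \<le> t" for s c
    proof -
      have "dist x (x + s *\<^sub>R u + c *\<^sub>R v) < r"
        using small[OF that] tK(1) dist_add[of s c] by simp
      from r(2)[OF this]
      show ?thesis
        by (rule has_derivative_compose[rotated]) (auto intro!: derivative_eq_intros)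
    qed
    have Dlin: "D (x + s *\<^sub>R u + c *\<^sub>R v) (h *\<^sub>R u) = h * D (x + s *\<^sub>R u + c *\<^sub>R v) u"
      if "0 \<le> s" "s \<le> t" "0 \<le> c" "c \<le> t" for s c h
    proof -
      have "dist x (x + s *\<^sub>R u + c *\<^sub>R v) < r"
        using small[OF that] tK(1) dist_add[of s c] by simp
      from has_derivative_linear[OF r(2)[OF this]] show ?thesis by (simp add: linear_scale)
    qed
    have "\<exists>\<xi>. 0 < \<xi> \<and> \<xi> < t \<and> g t - g 0 = (t - 0) * (D (x + \<xi> *\<^sub>R u + t *\<^sub>R v) u - D (x + \<xi> *\<^sub>R u + 0 *\<^sub>R v) u)"
    proof (rule MVT2[OF t(1)])
      fix s assume s: "0 \<le> s" "s \<le> t"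
      have "(g has_derivative (\<lambda>h. D (x + s *\<^sub>R u + t *\<^sub>R v) (h *\<^sub>R u) - D (x + s *\<^sub>R u + 0 *\<^sub>R v) (h *\<^sub>R u))) (at s)"
        using has_derivative_diff[OF der[of s t] der[of s 0]] s t(1) by (simp add: g_def[abs_def])
      moreover have "D (x + s *\<^sub>R u + t *\<^sub>R v) (h *\<^sub>R u) - D (x + s *\<^sub>R u + 0 *\<^sub>R v) (h *\<^sub>R u) =
          (D (x + s *\<^sub>R u + t *\<^sub>R v) u - D (x + s *\<^sub>R u + 0 *\<^sub>R v) u) * h" for h
        using Dlin[of s t h] Dlin[of s 0 h] s t(1) by (simp add: algebra_simps)
      ultimately show "(g has_real_derivative D (x + s *\<^sub>R u + t *\<^sub>R v) u - D (x + s *\<^sub>R u + 0 *\<^sub>R v) u) (at s)"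
        unfolding has_field_derivative_def by (metis (no_types, lifting) has_derivative_eq_rhs ext)
    qed
    then obtain \<xi> where \<xi>: "0 < \<xi>" "\<xi> < t"
      and mvt: "g t - g 0 = t * (D (x + \<xi> *\<^sub>R u + t *\<^sub>R v) u - D (x + \<xi> *\<^sub>R u + 0 *\<^sub>R v) u)" by auto
    have est: "\<bar>D (x + \<xi> *\<^sub>R u + c *\<^sub>R v) u - D x u - B (\<xi> *\<^sub>R u + c *\<^sub>R v) u\<bar> \<le> e / 2 * t" if "0 \<le> c" "c \<le> t" for c
    proof -
      have n: "norm (\<xi> *\<^sub>R u + c *\<^sub>R v) \<le> t * K" using small[of \<xi> c] \<xi> that by simp
      have "\<bar>D (x + (\<xi> *\<^sub>R u + c *\<^sub>R v)) u - D x u - B (\<xi> *\<^sub>R u + c *\<^sub>R v) u\<bar> \<le> e / (2 * K) * norm (\<xi> *\<^sub>R u + c *\<^sub>R v)"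
        using d(2)[of "x + (\<xi> *\<^sub>R u + c *\<^sub>R v)"] n tK(2) by simp
      also have "\<dots> \<le> e / (2 * K) * (t * K)" using n e K by (intro mult_left_mono) auto
      also have "\<dots> = e / 2 * t" using K by simp
      finally show ?thesis by (simp add: add.assoc)
    qed
    have "B (\<xi> *\<^sub>R u + t *\<^sub>R v) u - B (\<xi> *\<^sub>R u + 0 *\<^sub>R v) u = t * B v u"
      using linear_add[OF bounded_linear.linear[OF lin], of "\<xi> *\<^sub>R u" "t *\<^sub>R v"]
        linear_scale[OF bounded_linear.linear[OF lin], of t v] by simp
    then have "\<bar>(D (x + \<xi> *\<^sub>R u + t *\<^sub>R v) u - D (x + \<xi> *\<^sub>R u + 0 *\<^sub>R v) u) - t * B v u\<bar> \<le> e * t"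
      using est[of t] est[of 0] t(1) by linarith
    then have "t * \<bar>(D (x + \<xi> *\<^sub>R u + t *\<^sub>R v) u - D (x + \<xi> *\<^sub>R u + 0 *\<^sub>R v) u) - t * B v u\<bar> \<le> t * (e * t)"
      using t(1) by (intro mult_left_mono) auto
    moreover have "t * \<bar>(D (x + \<xi> *\<^sub>R u + t *\<^sub>R v) u - D (x + \<xi> *\<^sub>R u + 0 *\<^sub>R v) u) - t * B v u\<bar> =
        \<bar>g t - g 0 - t\<^sup>2 * B v u\<bar>"
    proof -
      have "g t - g 0 - t\<^sup>2 * B v u =
          t * ((D (x + \<xi> *\<^sub>R u + t *\<^sub>R v) u - D (x + \<xi> *\<^sub>R u + 0 *\<^sub>R v) u) - t * B v u)"
        unfolding mvt by (simp add: algebra_simps power2_eq_square)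
      then show ?thesis using t(1) by (simp add: abs_mult)
    qed
    ultimately show ?thesis by (simp add: g_def power2_eq_square algebra_simps)
  qed
  ultimately show thesis by (rule that)
qed

text \<open>The second difference is symmetric in u and v, and divided by t^2 it approximates both B
  v u and B u v.\<close>

lemma second_derivative_symmetric:
  fixes f :: "'b::real_normed_vector \<Rightarrow> real"
  assumes W: "open W" "x \<in> W" "\<And>y. y \<in> W \<Longrightarrow> (f has_derivative D y) (at y)"
    and B: "\<And>u. ((\<lambda>y. D y u) has_derivative (\<lambda>h. B h u)) (at x)"
  shows "B u v = B v u"
proof -
  obtain r where r: "0 < r" "ball x r \<subseteq> W" using W(1,2) openE by blast
  have der: "(f has_derivative D y) (at y)" if "dist x y < r" for y
    using W(3) r(2) that by (auto simp: subset_iff)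
  have "\<bar>B u v - B v u\<bar> \<le> 0 + e" if "0 < e" for e
  proof -
    have e: "0 < e / 2" using that by simp
    obtain d1 where d1: "0 < d1" "\<And>t. 0 < t \<Longrightarrow> t < d1 \<Longrightarrow>
        \<bar>f (x + t *\<^sub>R u + t *\<^sub>R v) - f (x + t *\<^sub>R u) - f (x + t *\<^sub>R v) + f x - t\<^sup>2 * B v u\<bar> \<le> e / 2 * t\<^sup>2"
      using second_difference_bound[where f = f and D = D and B = B and x = x and u = u and v = v, OF r(1) der B e] by blast
    obtain d2 where d2: "0 < d2" "\<And>t. 0 < t \<Longrightarrow> t < d2 \<Longrightarrow>
        \<bar>f (x + t *\<^sub>R v + t *\<^sub>R u) - f (x + t *\<^sub>R v) - f (x + t *\<^sub>R u) + f x - t\<^sup>2 * B u v\<bar> \<le> e / 2 * t\<^sup>2"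
      using second_difference_bound[where f = f and D = D and B = B and x = x and u = v and v = u, OF r(1) der B e] by blast
    define t where "t = min d1 d2 / 2"
    have t: "0 < t" "t < d1" "t < d2" using d1(1) d2(1) by (auto simp: t_def)
    have comm: "x + t *\<^sub>R v + t *\<^sub>R u = x + t *\<^sub>R u + t *\<^sub>R v" by (simp add: algebra_simps)
    have "\<bar>t\<^sup>2 * B u v - t\<^sup>2 * B v u\<bar> \<le> e * t\<^sup>2"
      using d1(2)[OF t(1,2)] d2(2)[OF t(1,3)] unfolding comm by linarith
    moreover have "t\<^sup>2 * B u v - t\<^sup>2 * B v u = t\<^sup>2 * (B u v - B v u)" by (simp add: algebra_simps)
    ultimately have "t\<^sup>2 * \<bar>B u v - B v u\<bar> \<le> t\<^sup>2 * e"
      by (simp add: abs_mult mult.commute)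
    then show ?thesis using t(1) by simp
  qed
  then have "\<bar>B u v - B v u\<bar> \<le> 0" by (rule field_le_epsilon)
  then show ?thesis by simp
qed

text \<open>A product rule for a factor M that is merely continuous at x: M - M x is o(1) and g,
  vanishing at x, is O(|y - x|). It is what makes a continuous normal differentiable.\<close>

lemma has_derivative_inner_vanishing:
  fixes M g :: "'b::real_normed_vector \<Rightarrow> 'a::real_inner"
  assumes g: "(g has_derivative g') (at x within X)" "g x = 0"
    and M: "(M \<longlongrightarrow> M x) (at x within X)"
  shows "((\<lambda>y. M y \<bullet> g y) has_derivative (\<lambda>h. M x \<bullet> g' h)) (at x within X)"
proof -
  obtain K where K: "0 < K" "\<And>h. norm (g' h) \<le> norm h * K"
    using bounded_linear.pos_bounded[OF has_derivative_bounded_linear[OF g(1)]] by blast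
  obtain d1 where d1: "0 < d1" "\<And>y. y \<in> X \<Longrightarrow> norm (y - x) < d1 \<Longrightarrow> norm (g y - g x - g' (y - x)) \<le> 1 * norm (y - x)"
    using g(1) unfolding has_derivative_within_alt by (meson zero_less_one)
  have gb: "norm (g y) \<le> (1 + K) * norm (y - x)" if "y \<in> X" "norm (y - x) < d1" for y
    using d1(2)[OF that] K(2)[of "y - x"] norm_triangle_ineq2[of "g y" "g' (y - x)"] g(2) by (simp add: algebra_simps)
  have "((\<lambda>y. (M y - M x) \<bullet> g y) has_derivative (\<lambda>h. 0)) (at x within X)"
    unfolding has_derivative_within_alt
  proof (intro conjI allI impI)
    fix e :: real assume "0 < e"
    then have "0 < e / (1 + K)" using K by simp
    then have "\<forall>\<^sub>F y in at x within X. dist (M y) (M x) < e / (1 + K)" by (rule tendstoD[OF M])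
    then obtain d2 where d2: "0 < d2" "\<And>y. y \<in> X \<Longrightarrow> y \<noteq> x \<Longrightarrow> dist y x < d2 \<Longrightarrow> dist (M y) (M x) < e / (1 + K)"
      by (auto simp: eventually_at)
    have "norm ((M y - M x) \<bullet> g y - (M x - M x) \<bullet> g x - 0) \<le> e * norm (y - x)"
      if "y \<in> X" "norm (y - x) < min d1 d2" for y
    proof (cases "y = x")
      case False
      have "\<bar>(M y - M x) \<bullet> g y\<bar> \<le> norm (M y - M x) * norm (g y)" by (rule Cauchy_Schwarz_ineq2)
      also have "\<dots> \<le> e / (1 + K) * ((1 + K) * norm (y - x))"
        using d2(2)[OF that(1) False] that gb[OF that(1)] \<open>0 < e / (1 + K)\<close>
        by (intro mult_mono) (auto simp: dist_norm)
      finally show ?thesis using K by simp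
    qed simp
    then show "\<exists>d>0. \<forall>y\<in>X. norm (y - x) < d \<longrightarrow> norm ((M y - M x) \<bullet> g y - (M x - M x) \<bullet> g x - 0) \<le> e * norm (y - x)"
      using d1(1) d2(1) by (intro exI[of _ "min d1 d2"]) auto
  qed simp
  from has_derivative_add[OF has_derivative_inner_right[OF g(1)] this, of "M x"]
  show ?thesis by (simp add: inner_diff_left)
qed

text \<open>Differentiates the inverse of a parametrisation at interior and boundary points alike. A
  maps into a larger space, so G is a left inverse only.\<close>

lemma has_derivative_left_inverse_within:
  fixes f :: "'b::real_normed_vector \<Rightarrow> 'a::real_normed_vector"
  assumes f: "(f has_derivative A) (at x within X)"
    and G: "bounded_linear G" "\<And>u. G (A u) = u"
    and g: "(g \<longlongrightarrow> x) (at (f x) within Y)" "g (f x) = x"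
    and gY: "\<And>y. y \<in> Y \<Longrightarrow> g y \<in> X" "\<And>y. y \<in> Y \<Longrightarrow> f (g y) = y"
  shows "(g has_derivative G) (at (f x) within Y)"
proof -
  let ?z = "f x"
  interpret G: bounded_linear G by fact
  obtain K where K: "0 < K" "\<And>h. norm (G h) \<le> norm h * K" using G.pos_bounded by blast
  have est: "\<exists>d>0. \<forall>y\<in>Y. norm (y - ?z) < d \<longrightarrow> norm (g y - x - G (y - ?z)) \<le> e * norm (g y - x)"
    if "0 < e" for e
  proof -
    from that K have "0 < e / K" by simp
    then obtain d1 where d1: "0 < d1" "\<And>u. u \<in> X \<Longrightarrow> norm (u - x) < d1 \<Longrightarrow> norm (f u - f x - A (u - x)) \<le> e / K * norm (u - x)"
      using f unfolding has_derivative_within_alt by blast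
    from tendstoD[OF g(1) d1(1)] obtain d2 where d2: "0 < d2"
      "\<And>y. y \<in> Y \<Longrightarrow> y \<noteq> ?z \<Longrightarrow> dist y ?z < d2 \<Longrightarrow> dist (g y) x < d1"
      by (auto simp: eventually_at)
    have "norm (g y - x - G (y - ?z)) \<le> e * norm (g y - x)" if y: "y \<in> Y" "norm (y - ?z) < d2" for y
    proof (cases "y = ?z")
      case False
      have "g y - x - G (y - ?z) = - G (f (g y) - f x - A (g y - x))"
        by (simp add: G.diff G(2) gY(2)[OF y(1)])
      then have "norm (g y - x - G (y - ?z)) \<le> norm (f (g y) - f x - A (g y - x)) * K"
        using K(2) by (metis norm_minus_cancel)
      also have "\<dots> \<le> e / K * norm (g y - x) * K"
        using d1(2)[OF gY(1)[OF y(1)]] d2(2)[OF y(1) False] y(2) K(1)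
        by (intro mult_right_mono) (auto simp: dist_norm)
      finally show ?thesis using K(1) by simp
    qed (simp add: g(2) G.zero)
    with d2(1) show ?thesis by blast
  qed
  \<comment> \<open>The error is so far measured by |g y - x|. With the factor 1/2 it gives a
    Lipschitz bound, which converts it to |y - f x|.\<close>
  obtain d0 where d0: "0 < d0" "\<And>y. y \<in> Y \<Longrightarrow> norm (y - ?z) < d0 \<Longrightarrow> norm (g y - x - G (y - ?z)) \<le> 1/2 * norm (g y - x)"
    using est[of "1/2"] by auto
  have lip: "norm (g y - x) \<le> 2 * K * norm (y - ?z)" if "y \<in> Y" "norm (y - ?z) < d0" for y
    using d0(2)[OF that] norm_triangle_ineq2[of "g y - x" "G (y - ?z)"] K(2)[of "y - ?z"] by (simp add: algebra_simps)
  show ?thesis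
    unfolding has_derivative_within_alt g(2)
  proof (intro conjI allI impI G(1))
    fix e :: real assume "0 < e"
    then have "0 < e / (2 * K)" using K by simp
    then obtain d where d: "0 < d" "\<And>y. y \<in> Y \<Longrightarrow> norm (y - ?z) < d \<Longrightarrow> norm (g y - x - G (y - ?z)) \<le> e / (2 * K) * norm (g y - x)"
      using est by blast
    have "norm (g y - x - G (y - ?z)) \<le> e * norm (y - ?z)" if "y \<in> Y" "norm (y - ?z) < min d d0" for y
    proof -
      have "norm (g y - x - G (y - ?z)) \<le> e / (2 * K) * norm (g y - x)" using d(2) that by simp
      also have "\<dots> \<le> e / (2 * K) * (2 * K * norm (y - ?z))"
        using lip that \<open>0 < e / (2 * K)\<close> by (intro mult_left_mono) auto
      finally show ?thesis using K(1) by simp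
    qed
    then show "\<exists>d>0. \<forall>y\<in>Y. norm (y - ?z) < d \<longrightarrow> norm (g y - x - G (y - ?z)) \<le> e * norm (y - ?z)"
      using d(1) d0(1) by (intro exI[of _ "min d d0"]) auto
  qed
qed

section \<open>The unit normal of a hypersurface\<close>

text \<open>If the ray from x along u stays in H, its image is a curve in S with velocity a positive
  multiple of A u. Otherwise the ray along -u stays in H, and the span supplies the sign.\<close>

lemma range_derivative_subset_tangent_space:
  fixes \<phi> :: "'b::euclidean_space \<Rightarrow> 'a::euclidean_space"
  assumes W: "open W" and H: "H = UNIV \<or> (\<exists>a. a \<noteq> 0 \<and> H = {x. 0 \<le> a \<bullet> x})"
    and \<phi>: "\<phi> ` (W \<inter> H) \<subseteq> S" "(\<phi> has_derivative A) (at x)" and x: "x \<in> W \<inter> H"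
  shows "A u \<in> tangent_space S (\<phi> x)"
proof -
  have A: "linear A" using \<phi>(2) by (rule has_derivative_linear)
  have sub: "subspace (tangent_space S (\<phi> x))" by (simp add: tangent_space_def)
  have inward: "A u \<in> tangent_space S (\<phi> x)" if u: "\<And>s. 0 \<le> s \<Longrightarrow> x + s *\<^sub>R u \<in> H" for u
  proof -
    obtain r where r: "0 < r" "ball x r \<subseteq> W" using W x openE by blast
    \<comment> \<open>Slows the curve down so that its parameter runs through all of [0, 1] without
      leaving the ball in W.\<close>
    define c where "c = r / (1 + norm u)"
    have nu: "0 < 1 + norm u" by (simp add: add_pos_nonneg)
    have c: "0 < c" using r nu by (simp add: c_def)
    have cu: "c * norm u < r" using r nu by (simp add: c_def field_simps)
    define \<gamma> where "\<gamma> s = \<phi> (x + (s * c) *\<^sub>R u)" for s :: real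
    have "\<gamma> s \<in> S" if s: "s \<in> {0..1}" for s
    proof -
      have "norm ((s * c) *\<^sub>R u) = s * (c * norm u)" using s c by simp
      also have "\<dots> \<le> 1 * (c * norm u)" using s c by (intro mult_right_mono) auto
      finally have "norm ((s * c) *\<^sub>R u) < r" using cu by linarith
      then have "x + (s * c) *\<^sub>R u \<in> W" using r(2) by (auto simp: dist_norm subset_iff)
      moreover have "x + (s * c) *\<^sub>R u \<in> H" using s c by (intro u) simp
      ultimately show ?thesis using \<phi>(1) by (auto simp: \<gamma>_def)
    qed
    moreover have "(\<gamma> has_vector_derivative c *\<^sub>R A u) (at 0 within {0..1})"
    proof -
      have "((\<lambda>s. x + (s * c) *\<^sub>R u) has_derivative (\<lambda>h. (h * c) *\<^sub>R u)) (at 0 within {0..1})"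
        by (auto intro!: derivative_eq_intros)
      moreover have "(\<phi> has_derivative A) (at (x + (0 * c) *\<^sub>R u))" using \<phi>(2) by simp
      ultimately have "((\<lambda>s. \<phi> (x + (s * c) *\<^sub>R u)) has_derivative (\<lambda>h. A ((h * c) *\<^sub>R u))) (at 0 within {0..1})"
        by (rule has_derivative_compose)
      then show ?thesis
        by (simp add: has_vector_derivative_def \<gamma>_def[abs_def] linear_scale[OF A])
    qed
    ultimately have "c *\<^sub>R A u \<in> tangent_space S (\<phi> x)"
      unfolding tangent_space_def by (intro span_base) (auto intro!: exI[of _ \<gamma>] simp: \<gamma>_def)
    from subspace_scale[OF sub this, of "1 / c"] show ?thesis using c by simp
  qed
  show ?thesis
  proof (cases "\<forall>s\<ge>0. x + s *\<^sub>R u \<in> H")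
    case False
    then obtain a where a: "H = {x. 0 \<le> a \<bullet> x}" using H by auto
    have "a \<bullet> u < 0" using False x by (auto simp: a inner_add_right not_le) (smt (verit) mult_nonneg_nonneg)
    then have "A (- u) \<in> tangent_space S (\<phi> x)"
      using x by (intro inward) (auto simp: a inner_diff_right, smt (verit) mult_nonneg_nonpos)
    then show ?thesis using subspace_neg[OF sub] by (fastforce simp: linear_neg[OF A])
  qed (use inward in blast)
qed

lemma range_eq_orthogonal_hyperplane:
  fixes A :: "'b::euclidean_space \<Rightarrow> 'a::euclidean_space"
  assumes A: "linear A" "inj A" and d: "DIM('a) = Suc DIM('b)"
    and n: "n \<noteq> 0" "\<And>u. n \<bullet> A u = 0"
  shows "range A = {v. n \<bullet> v = 0}"
proof (rule subspace_dim_equal)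
  show "subspace (range A)" using linear_subspace_image[OF A(1) subspace_UNIV] .
  have "dim (range A) = DIM('b)" using dim_image_eq[OF A(1), of UNIV] A(2) by simp
  then show "dim {v. n \<bullet> v = 0} \<le> dim (range A)" using dim_hyperplane[OF n(1)] d by simp
qed (use n in \<open>auto simp: subspace_hyperplane\<close>)

text \<open>Coordinates \<open>(p, \<alpha>)\<close> dual to the frame formed by the columns of \<open>A\<close> and \<open>n\<close>.\<close>
lemma dual_frame:
  fixes A :: "'b::euclidean_space \<Rightarrow> 'a::euclidean_space"
  assumes A: "linear A" "inj A" and d: "DIM('a) = Suc DIM('b)"
    and n: "norm n = 1" "\<And>u. n \<bullet> A u = 0"
  obtains J :: "'b \<times> real \<Rightarrow> 'a" where "linear J"
    "\<And>w. J (\<Sum>i\<in>Basis. (w \<bullet> A i) *\<^sub>R i, w \<bullet> n) = w"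
    "\<And>p \<alpha> u. J (p, \<alpha>) \<bullet> A u = p \<bullet> u" "\<And>p \<alpha>. J (p, \<alpha>) \<bullet> n = \<alpha>"
proof -
  define \<Phi> :: "'a \<Rightarrow> 'b \<times> real" where "\<Phi> w = (\<Sum>i\<in>Basis. (w \<bullet> A i) *\<^sub>R i, w \<bullet> n)" for w
  have Aexp: "A u = (\<Sum>i\<in>Basis. (u \<bullet> i) *\<^sub>R A i)" for u
    by (subst euclidean_representation[of u, symmetric])
       (simp only: linear_sum[OF A(1)] linear_scale[OF A(1)])
  have \<Phi>A: "w \<bullet> A u = fst (\<Phi> w) \<bullet> u" for w u
    by (subst Aexp) (simp add: \<Phi>_def inner_sum_left inner_sum_right inner_commute mult.commute)
  have lin: "linear \<Phi>"
    by (rule linearI) (simp_all add: \<Phi>_def inner_add_left scaleR_add_left sum.distrib scaleR_sum_right)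
  \<comment> \<open>Such a w is orthogonal to n, hence in the range of A, and also orthogonal to
    that range.\<close>
  have "w = 0" if "\<Phi> w = 0" for w
  proof -
    have "w \<bullet> n = 0" "\<And>u. w \<bullet> A u = 0" using that by (simp_all add: \<Phi>A) (simp add: \<Phi>_def zero_prod_def)
    moreover from this(1) have "w \<in> range A"
      using n by (subst range_eq_orthogonal_hyperplane[OF A d, of n]) (auto simp: inner_commute)
    ultimately show ?thesis by (metis imageE inner_eq_zero_iff)
  qed
  then have inj: "inj \<Phi>" using linear_injective_0[OF lin] by blast
  then obtain J where J: "linear J" "J \<circ> \<Phi> = id"
    using linear_injective_left_inverse[OF lin] by blast
  have "dim (range \<Phi>) = DIM('b \<times> real)"
    using dim_image_eq[OF lin, of UNIV] inj d by simp
  then have "span (range \<Phi>) = UNIV" by (simp only: dim_eq_full)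
  then have "surj \<Phi>" using linear_subspace_image[OF lin subspace_UNIV] by (simp add: span_eq_iff[symmetric])
  then have \<Phi>J: "\<Phi> (J q) = q" for q using J(2) by (metis comp_apply id_apply surjD)
  show thesis
  proof (rule that)
    show "J (\<Sum>i\<in>Basis. (w \<bullet> A i) *\<^sub>R i, w \<bullet> n) = w" for w
      using fun_cong[OF J(2), of w] by (simp add: \<Phi>_def)
    show "J (p, \<alpha>) \<bullet> A u = p \<bullet> u" for p \<alpha> u by (simp add: \<Phi>A \<Phi>J)
    show "J (p, \<alpha>) \<bullet> n = \<alpha>" for p \<alpha>
      using arg_cong[OF \<Phi>J[of "(p, \<alpha>)"], of snd] by (simp add: \<Phi>_def)
  qed fact
qed

text \<open>
  A continuous unit field \<open>M\<close> normal to the frame \<open>F\<close> is differentiable because its tangential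
  part \<open>\<tau>\<close> is, and because its normal part satisfies \<open>\<alpha> - 1 = - (\<tau> \<bullet> \<tau>) / (1 + \<alpha>)\<close>.
\<close>
lemma unit_normal_has_derivative:
  fixes M :: "'b::euclidean_space \<Rightarrow> 'a::euclidean_space"
    and F :: "'b \<Rightarrow> 'b \<Rightarrow>\<^sub>L 'a" and F' :: "'b \<Rightarrow> 'b \<Rightarrow>\<^sub>L 'a"
  assumes d: "DIM('a) = Suc DIM('b)" and x: "x \<in> X"
    and M: "\<And>y. y \<in> X \<Longrightarrow> norm (M y) = 1" "\<And>y u. y \<in> X \<Longrightarrow> M y \<bullet> F y u = 0"
      "(M \<longlongrightarrow> M x) (at x within X)"
    and F: "(F has_derivative F') (at x within X)" "inj (blinfun_apply (F x))"
  obtains D where "(M has_derivative D) (at x within X)"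
    "\<And>u w. D u \<bullet> F x w = - (M x \<bullet> F' u w)" "\<And>u. D u \<bullet> M x = 0"
proof -
  let ?n = "M x"
  have linF: "linear (blinfun_apply G)" for G :: "'b \<Rightarrow>\<^sub>L 'a"
    by (rule bounded_linear.linear[OF blinfun.bounded_linear_right])
  obtain J :: "'b \<times> real \<Rightarrow> 'a" where J: "linear J"
    "\<And>w. J (\<Sum>i\<in>Basis. (w \<bullet> F x i) *\<^sub>R i, w \<bullet> ?n) = w"
    "\<And>p \<alpha> u. J (p, \<alpha>) \<bullet> F x u = p \<bullet> u" "\<And>p \<alpha>. J (p, \<alpha>) \<bullet> ?n = \<alpha>"
    using dual_frame[OF linF F(2) d M(1)[OF x] M(2)[OF x]] by blast
  \<comment> \<open>M y is normal to F y, so M y . F x w = M y . (F x w - F y w), whose second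
    factor vanishes at y = x; continuity of M is then enough.\<close>
  have tang: "((\<lambda>y. M y \<bullet> F x w) has_derivative (\<lambda>u. - (?n \<bullet> F' u w))) (at x within X)" for w
  proof -
    have "((\<lambda>y. F y w) has_derivative (\<lambda>u. F' u w)) (at x within X)"
      by (rule bounded_linear.has_derivative[OF blinfun.bounded_linear_left F(1)])
    from has_derivative_diff[OF has_derivative_const[of "F x w"] this]
    have "((\<lambda>y. F x w - F y w) has_derivative (\<lambda>u. - F' u w)) (at x within X)" by simp
    from has_derivative_inner_vanishing[OF this _ M(3)]
    have "((\<lambda>y. M y \<bullet> (F x w - F y w)) has_derivative (\<lambda>u. - (?n \<bullet> F' u w))) (at x within X)"
      by simp
    then show ?thesis
      by (rule has_derivative_transform[OF x, rotated]) (simp add: inner_diff_right M(2))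
  qed
  define p where "p y = (\<Sum>i\<in>Basis. (M y \<bullet> F x i) *\<^sub>R i)" for y
  define p' where "p' u = (\<Sum>i\<in>Basis. - (?n \<bullet> F' u i) *\<^sub>R i)" for u
  define \<tau> where "\<tau> y = J (p y, 0)" for y
  define \<tau>' where "\<tau>' u = J (p' u, 0)" for u
  define \<alpha> where "\<alpha> y = M y \<bullet> ?n" for y
  have J0: "J (0, a) = a *\<^sub>R ?n" for a
  proof -
    have "J (0, 1) = ?n" using J(2)[of ?n] M(1)[OF x] M(2)[OF x] by (simp add: norm_eq_1)
    moreover have "J (a *\<^sub>R (0, 1)) = a *\<^sub>R J (0, 1)" by (rule linear_scale[OF J(1)])
    ultimately show ?thesis by simp
  qed
  have dec: "M y = \<tau> y + \<alpha> y *\<^sub>R ?n" for y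
    using J(2)[of "M y"] linear_add[OF J(1), of "(p y, 0)" "(0, \<alpha> y)"]
    by (simp add: p_def \<tau>_def \<alpha>_def J0)
  have p: "(p has_derivative p') (at x within X)"
    unfolding p_def[abs_def] p'_def[abs_def]
    by (intro has_derivative_sum has_derivative_scaleR_left tang)
  have \<tau>: "(\<tau> has_derivative \<tau>') (at x within X)"
    unfolding \<tau>_def[abs_def] \<tau>'_def[abs_def]
    by (rule bounded_linear.has_derivative[OF _ has_derivative_Pair[OF p has_derivative_const]])
       (simp add: J(1) linear_conv_bounded_linear[symmetric])
  have "p x = 0" using M(2)[OF x] by (simp add: p_def)
  then have \<tau>x: "\<tau> x = 0" using J0[of 0] by (simp add: \<tau>_def)
  have \<alpha>x: "\<alpha> x = 1" using M(1)[OF x] by (simp add: \<alpha>_def norm_eq_1)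
  have \<alpha>lim: "(\<alpha> \<longlongrightarrow> \<alpha> x) (at x within X)"
    unfolding \<alpha>_def by (intro tendsto_inner M(3) tendsto_const)
  have \<tau>lim: "(\<tau> \<longlongrightarrow> \<tau> x) (at x within X)"
    using has_derivative_continuous[OF \<tau>] by (simp add: continuous_within)
  have "((\<lambda>y. \<tau> y \<bullet> \<tau> y) has_derivative (\<lambda>u. 0)) (at x within X)"
    using has_derivative_inner_vanishing[OF \<tau> \<tau>x \<tau>lim] \<tau>x by simp
  moreover have "((\<lambda>y. - 1 / (1 + \<alpha> y)) \<longlongrightarrow> - 1 / (1 + \<alpha> x)) (at x within X)"
    by (intro tendsto_intros \<alpha>lim) (simp add: \<alpha>x)
  ultimately have "((\<lambda>y. (- 1 / (1 + \<alpha> y)) \<bullet> (\<tau> y \<bullet> \<tau> y)) has_derivative (\<lambda>u. 0)) (at x within X)"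
    using has_derivative_inner_vanishing[of "\<lambda>y. \<tau> y \<bullet> \<tau> y" "\<lambda>u. 0" x X "\<lambda>y. - 1 / (1 + \<alpha> y)"] \<tau>x
    by simp
  from has_derivative_add[OF has_derivative_const[of 1] this]
  have "((\<lambda>y. 1 + (- 1 / (1 + \<alpha> y)) \<bullet> (\<tau> y \<bullet> \<tau> y)) has_derivative (\<lambda>u. 0)) (at x within X)" by simp
  then have "(\<alpha> has_derivative (\<lambda>u. 0)) (at x within X)"
  proof (rule has_derivative_transform_eventually)
    \<comment> \<open>Near x the normal part is close to 1. This excludes the other root of
      \<alpha>^2 = 1 - |\<tau>|^2 and keeps 1 + \<alpha> away from 0.\<close>
    have "\<forall>\<^sub>F y in at x within X. 0 < \<alpha> y"
      using order_tendstoD(1)[OF \<alpha>lim, of 0] \<alpha>x by simp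
    moreover have "\<forall>\<^sub>F y in at x within X. y \<in> X" by (simp add: eventually_at_filter)
    ultimately show "\<forall>\<^sub>F y in at x within X. 1 + (- 1 / (1 + \<alpha> y)) \<bullet> (\<tau> y \<bullet> \<tau> y) = \<alpha> y"
    proof eventually_elim
      case (elim y)
      have "M y \<bullet> M y = 1" "?n \<bullet> ?n = 1" using M(1) x elim by (simp_all add: norm_eq_1)
      moreover have "\<tau> y \<bullet> ?n = 0" "?n \<bullet> \<tau> y = 0" by (simp_all add: \<tau>_def J(4) inner_commute[of ?n])
      moreover have "M y \<bullet> M y = (\<tau> y + \<alpha> y *\<^sub>R ?n) \<bullet> (\<tau> y + \<alpha> y *\<^sub>R ?n)" using dec[of y] by simp
      ultimately have "\<tau> y \<bullet> \<tau> y = 1 - \<alpha> y * \<alpha> y"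
        by (simp add: inner_add_left inner_add_right)
      then show ?case using elim by (simp add: field_simps)
    qed
  qed (simp_all add: \<tau>x \<alpha>x x)
  from has_derivative_add[OF \<tau> has_derivative_scaleR_left[OF this, of ?n]]
  have "((\<lambda>y. \<tau> y + \<alpha> y *\<^sub>R ?n) has_derivative \<tau>') (at x within X)" by simp
  then have "(M has_derivative \<tau>') (at x within X)" by (simp only: dec[symmetric])
  moreover have "\<tau>' u \<bullet> F x w = - (?n \<bullet> F' u w)" for u w
  proof -
    have "F' u w = (\<Sum>i\<in>Basis. (w \<bullet> i) *\<^sub>R F' u i)"
      by (subst euclidean_representation[of w, symmetric])
         (simp only: linear_sum[OF linF] linear_scale[OF linF])
    then have "?n \<bullet> F' u w = (\<Sum>i\<in>Basis. (w \<bullet> i) * (?n \<bullet> F' u i))" by (simp add: inner_sum_right)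
    then show ?thesis
      unfolding \<tau>'_def J(3) by (simp add: p'_def inner_sum_left inner_commute[of w] sum_negf mult.commute)
  qed
  moreover have "\<tau>' u \<bullet> ?n = 0" for u by (simp add: \<tau>'_def J(4))
  ultimately show thesis by (rule that)
qed

text \<open>N is differentiated along the chart and carried back by the inverse chart. Its
  derivative pairs with tangent vectors as minus the normal part of the second derivative of the
  chart, so symmetry of the latter gives that of the former.\<close>

lemma hypersurface_normal_derivative:
  fixes S :: "'a::euclidean_space set"
  assumes S: "C2_surface TYPE('b::euclidean_space) S" and N: "unit_normal_field S N"
    and d: "DIM('a) = Suc DIM('b)" and z: "z \<in> S"
  obtains D where "tangent_space S z = {v. N z \<bullet> v = 0}" "(N has_derivative D) (at z within S)"
    "\<And>v. D v \<bullet> N z = 0"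
    "\<And>v w. v \<in> tangent_space S z \<Longrightarrow> w \<in> tangent_space S z \<Longrightarrow> D v \<bullet> w = v \<bullet> D w"
proof -
  obtain U W H and \<phi> :: "'b \<Rightarrow> 'a" and \<psi> where U: "open U" "z \<in> U" and W: "open W"
    and H: "H = UNIV \<or> (\<exists>a. a \<noteq> 0 \<and> H = {x. 0 \<le> a \<bullet> x})" and C2: "C2_on W \<phi>"
    and inj: "\<forall>x \<in> W \<inter> H. inj (frechet_derivative \<phi> (at x))"
    and hom: "homeomorphism (W \<inter> H) (S \<inter> U) \<phi> \<psi>"
    using bspec[OF S[unfolded C2_surface_def] z] by (elim exE conjE) (rule that)
  obtain F :: "'b \<Rightarrow> 'b \<Rightarrow>\<^sub>L 'a" and F' :: "'b \<Rightarrow> 'b \<Rightarrow>\<^sub>L 'b \<Rightarrow>\<^sub>L 'a"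
    where F: "\<And>x. x \<in> W \<Longrightarrow> (\<phi> has_derivative F x) (at x)"
      "\<And>x. x \<in> W \<Longrightarrow> (F has_derivative F' x) (at x)"
    using C2 unfolding C2_on_def by blast
  have \<psi>: "\<psi> y \<in> W \<inter> H" "\<phi> (\<psi> y) = y" if "y \<in> S \<inter> U" for y
    using hom that by (auto simp: homeomorphism_def)
  have \<phi>S: "\<phi> ` (W \<inter> H) \<subseteq> S" and \<phi>c: "continuous_on (W \<inter> H) \<phi>" and \<psi>c: "continuous_on (S \<inter> U) \<psi>"
    using hom by (auto simp: homeomorphism_def)
  define x where "x = \<psi> z"
  have x: "x \<in> W \<inter> H" "\<phi> x = z" using \<psi>[of z] z U(2) by (auto simp: x_def)
  have Nc: "continuous_on S N" and N1: "\<And>y. y \<in> S \<Longrightarrow> norm (N y) = 1"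
    and Nt: "\<And>y v. y \<in> S \<Longrightarrow> v \<in> tangent_space S y \<Longrightarrow> N y \<bullet> v = 0"
    using N by (auto simp: unit_normal_field_def)
  have tan: "F y u \<in> tangent_space S (\<phi> y)" if "y \<in> W \<inter> H" for y u
    using that by (intro range_derivative_subset_tangent_space[OF W H \<phi>S F(1)]) auto
  have normal: "N (\<phi> y) \<bullet> F y u = 0" if "y \<in> W \<inter> H" for y u
    using Nt[OF _ tan[OF that]] \<phi>S that by blast
  have "frechet_derivative \<phi> (at x) = F x"
    using frechet_derivative_at[OF F(1)] x(1) by simp
  then have injF: "inj (F x)" using bspec[OF inj x(1)] by simp
  have linF: "linear (F x)" by (rule bounded_linear.linear[OF blinfun.bounded_linear_right])
  have rng: "range (F x) = {v. N z \<bullet> v = 0}"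
    using range_eq_orthogonal_hyperplane[OF linF injF d, of "N z"] N1[OF z] normal[OF x(1)] x(2) by force
  have T: "tangent_space S z = {v. N z \<bullet> v = 0}"
  proof
    show "{v. N z \<bullet> v = 0} \<subseteq> tangent_space S z" using tan[OF x(1)] x(2) by (auto simp: rng[symmetric])
  qed (use Nt[OF z] in auto)
  have "((\<lambda>y. N (\<phi> y)) \<longlongrightarrow> N (\<phi> x)) (at x within W \<inter> H)"
    using continuous_on_compose2[OF Nc \<phi>c \<phi>S] x(1) by (simp add: continuous_on)
  then obtain D0 where D0: "((\<lambda>y. N (\<phi> y)) has_derivative D0) (at x within W \<inter> H)"
    "\<And>u w. D0 u \<bullet> F x w = - (N (\<phi> x) \<bullet> F' x u w)" "\<And>u. D0 u \<bullet> N (\<phi> x) = 0"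
    using unit_normal_has_derivative[OF d x(1), of "\<lambda>y. N (\<phi> y)" F "F' x"] N1 \<phi>S normal injF
      has_derivative_at_withinI[OF F(2)] x(1) by blast
  obtain G where G: "linear G" "G \<circ> F x = id" using linear_injective_left_inverse[OF linF injF] by blast
  have GF: "G (F x u) = u" for u using G(2) by (metis comp_apply id_apply)
  \<comment> \<open>G is determined on the range of F x, which is the tangent space; off it G is an
    arbitrary extension.\<close>
  have "(\<psi> has_derivative G) (at (\<phi> x) within S \<inter> U)"
  proof (rule has_derivative_left_inverse_within)
    show "(\<phi> has_derivative F x) (at x within W \<inter> H)" using F(1) x(1) by (auto intro: has_derivative_at_withinI)
    show "bounded_linear G" using G(1) by (simp add: linear_conv_bounded_linear)
    show "(\<psi> \<longlongrightarrow> x) (at (\<phi> x) within S \<inter> U)" using \<psi>c z U(2) x(2) by (simp add: continuous_on x_def)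
  qed (use GF x \<psi> in \<open>auto simp: x_def\<close>)
  then have "(\<psi> has_derivative G) (at z within S \<inter> U)" using x(2) by simp
  moreover have "((\<lambda>y. N (\<phi> y)) has_derivative D0) (at (\<psi> z) within \<psi> ` (S \<inter> U))"
    using D0(1) \<psi>(1) by (auto simp: x_def[symmetric] intro: has_derivative_subset)
  ultimately have "((\<lambda>y. N (\<phi> (\<psi> y))) has_derivative (\<lambda>v. D0 (G v))) (at z within S \<inter> U)"
    by (rule has_derivative_in_compose)
  then have "(N has_derivative (\<lambda>v. D0 (G v))) (at z within S \<inter> U)"
    by (rule has_derivative_transform[rotated 2]) (use z U(2) \<psi>(2) in auto)
  moreover have "at z within S \<inter> U = at z within S"
    using U by (intro at_within_nhd[of _ U]) auto
  ultimately have der: "(N has_derivative (\<lambda>v. D0 (G v))) (at z within S)" by simp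
  \<comment> \<open>The chart is twice differentiable on the open set W, so second derivatives
    commute at x even if x lies on the boundary of H.\<close>
  have sym: "N z \<bullet> F' x u w = N z \<bullet> F' x w u" for u w
  proof (rule second_derivative_symmetric[where f = "\<lambda>y. N z \<bullet> \<phi> y" and D = "\<lambda>y u. N z \<bullet> F y u" and x = x])
    show "open W" "x \<in> W" using W x(1) by auto
    show "((\<lambda>y. N z \<bullet> \<phi> y) has_derivative (\<lambda>u. N z \<bullet> F y u)) (at y)" if "y \<in> W" for y
      by (rule has_derivative_inner_right[OF F(1)[OF that]])
    show "((\<lambda>y. N z \<bullet> F y u) has_derivative (\<lambda>h. N z \<bullet> F' x h u)) (at x)" for u
      using x(1) by (intro has_derivative_inner_right bounded_linear.has_derivative[OF blinfun.bounded_linear_left F(2)]) auto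
  qed
  show thesis
  proof (rule that[OF T der])
    show "D0 (G v) \<bullet> N z = 0" for v using D0(3) x(2) by simp
    fix v w assume "v \<in> tangent_space S z" "w \<in> tangent_space S z"
    then obtain a b where ab: "v = F x a" "w = F x b" unfolding T rng[symmetric] by blast
    have "D0 (G v) \<bullet> w = D0 (G w) \<bullet> v" by (simp add: ab GF D0(2) x(2) sym[of a b])
    then show "D0 (G v) \<bullet> w = v \<bullet> D0 (G w)" by (simp add: inner_commute)
  qed
qed

text \<open>Composition with a curve in S determines a derivative on the velocity of the curve, and
  linearity extends this to the span.\<close>

lemma has_derivative_unique_tangent_space:
  fixes S :: "'a::euclidean_space set" and f :: "'a \<Rightarrow> 'b::real_normed_vector"
  assumes D: "(f has_derivative D) (at z within S)" "(f has_derivative D') (at z within S)"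
    and v: "v \<in> tangent_space S z"
  shows "D v = D' v"
proof -
  let ?V = "{v. \<exists>\<gamma> :: real \<Rightarrow> 'a. \<gamma> 0 = z \<and> \<gamma> ` {0..1} \<subseteq> S \<and>
      (\<gamma> has_vector_derivative v) (at 0 within {0..1})}"
  have eq: "D v = D' v" if "v \<in> ?V" for v
  proof -
    from that obtain \<gamma> :: "real \<Rightarrow> 'a" where \<gamma>: "\<gamma> 0 = z" "\<gamma> ` {0..1} \<subseteq> S"
      "(\<gamma> has_vector_derivative v) (at 0 within {0..1})" by blast
    have der: "((\<lambda>s. f (\<gamma> s)) has_vector_derivative D v) (at 0 within {0..1})"
      if "(f has_derivative D) (at z within S)" for D
    proof -
      have "(f has_derivative D) (at (\<gamma> 0) within \<gamma> ` {0..1})" using that \<gamma>(1,2) by (auto intro: has_derivative_subset)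
      from has_derivative_in_compose[OF \<gamma>(3)[unfolded has_vector_derivative_def] this]
      show ?thesis by (simp add: has_vector_derivative_def linear_scale[OF has_derivative_linear[OF that]])
    qed
    show ?thesis
      using vector_derivative_unique_within_closed_interval[of 0 1 0 "\<lambda>s. f (\<gamma> s)"] der[OF D(1)] der[OF D(2)]
      by simp
  qed
  show ?thesis
    using linear_eq_on[OF has_derivative_linear[OF D(1)] has_derivative_linear[OF D(2)], of v ?V] eq v
    by (simp add: tangent_space_def)
qed

section \<open>The integral formula\<close>

text \<open>The bounded linear functional A -> (A v) . w passes through the matrix-valued integral
  and leaves scalar moments.\<close>

lemma tensor_quadratic_integral:
  fixes T :: "(real ^ 'n) set"
  assumes T: "subspace T" and fin: "hausdorff_outer (dim T - 1) (subspace_sphere T) < top"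
    and L: "linear L"
  shows "((LINT e : subspace_sphere T | hausdorff_measure (dim T - 1). (e \<bullet> L e) *\<^sub>R (a *\<^sub>R (e \<otimes>\<^sub>t e) - mat 1)) *v v) \<bullet> w =
    (LINT e | subspace_sphere_measure T. (e \<bullet> L e) * (a * ((e \<bullet> v) * (e \<bullet> w)) - v \<bullet> w))"
proof -
  let ?f = "\<lambda>e. (e \<bullet> L e) *\<^sub>R (a *\<^sub>R (e \<otimes>\<^sub>t e) - mat 1)"
  have "continuous_on UNIV L" using L by (simp add: linear_continuous_on linear_conv_bounded_linear)
  then have "continuous_on UNIV ?f" unfolding tensor_def by (intro continuous_intros)
  then have "integrable (subspace_sphere_measure T) ?f"
    by (rule continuous_imp_integrable_subspace_sphere[OF T fin])
  moreover have "bounded_linear (\<lambda>A :: real ^ 'n ^ 'n. (A *v v) \<bullet> w)"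
    unfolding linear_conv_bounded_linear[symmetric]
    by (rule linearI) (simp_all add: matrix_vector_mult_add_rdistrib inner_add_left scaleR_matrix_vector_assoc[symmetric])
  ultimately have "(LINT e | subspace_sphere_measure T. (?f e *v v) \<bullet> w) =
      (integral\<^sup>L (subspace_sphere_measure T) ?f *v v) \<bullet> w"
    by (intro integral_bounded_linear)
  then show ?thesis
    by (simp add: integral_subspace_sphere_measure[OF T] scaleR_matrix_vector_assoc[symmetric]
        matrix_vector_mult_diff_rdistrib tensor_mult_vec inner_diff_left mult.assoc)
qed

theorem proposition3p1:
  fixes n :: nat
    and S :: "(real ^ 'n) set"
    and N :: "real ^ 'n \<Rightarrow> real ^ 'n"
  assumes "n \<ge> 2" and "CARD('n) = n" and "CARD('m::finite) = n - 1"
    and "C2_surface TYPE(real ^ 'm) S"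
    and "unit_normal_field S N"
  shows "\<forall>z\<in>S. \<forall>v \<in> tangent_space S z.
    curvature_tensor S N z v =
      (((real n - 1) / (2 * measure (hausdorff_measure (n - 2)) (sphere (0 :: real ^ 'm) 1))) *\<^sub>R
        (LINT e : unit_tangents S z | hausdorff_measure (n - 2).
           directional_curvature S N z e *\<^sub>R ((real n + 1) *\<^sub>R (e \<otimes>\<^sub>t e) - mat 1))) *v v"
proof (intro ballI)
  fix z v assume z: "z \<in> S" and v: "v \<in> tangent_space S z"
  define T where "T = tangent_space S z"
  define L where "L = curvature_tensor S N z"
  define \<omega> where "\<omega> = measure (hausdorff_measure (n - 2)) (sphere (0 :: real ^ 'm) 1)"
  have d: "DIM(real ^ 'n) = Suc DIM(real ^ 'm)" using assms(1-3) by simp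
  obtain D where T: "T = {v. N z \<bullet> v = 0}" and D: "(N has_derivative D) (at z within S)"
    and Dn: "\<And>v. D v \<bullet> N z = 0"
    and Dsym: "\<And>v w. v \<in> T \<Longrightarrow> w \<in> T \<Longrightarrow> D v \<bullet> w = v \<bullet> D w"
    using hypersurface_normal_derivative[OF assms(4,5) d z] unfolding T_def by blast
  have nz: "norm (N z) = 1" using assms(5) z by (simp add: unit_normal_field_def)
  have subT: "subspace T" by (simp add: T_def tangent_space_def)
  have "N z \<noteq> 0" using nz by auto
  then have dimT: "dim T = n - 1" using dim_hyperplane[of "N z"] assms(2) by (simp add: T)
  have k: "dim T - 1 = n - 2" using dimT by simp
  have fd: "(N has_derivative frechet_derivative N (at z within S)) (at z within S)"
    using D by (auto simp: differentiable_def frechet_derivative_works[symmetric])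
  \<comment> \<open>\<open>frechet_derivative\<close> may select a map other than D; both agree on
    T.\<close>
  have LD: "L u = - D u" if "u \<in> T" for u
    using has_derivative_unique_tangent_space[OF fd D] that by (simp add: T_def L_def curvature_tensor_def)
  have "linear L"
    unfolding L_def curvature_tensor_def[abs_def]
    using has_derivative_linear[OF fd] by (intro linear_compose_neg)
  moreover have LT: "L u \<in> T" if "u \<in> T" for u
    using Dn[of u] that by (simp add: LD T inner_commute)
  moreover have "L u \<bullet> w = u \<bullet> L w" if "u \<in> T" "w \<in> T" for u w
    using Dsym[OF that] that by (simp add: LD)
  ultimately have L: "linear L" "\<And>u. u \<in> T \<Longrightarrow> L u \<in> T"
    "\<And>u w. u \<in> T \<Longrightarrow> w \<in> T \<Longrightarrow> L u \<bullet> w = u \<bullet> L w" by blast+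
  have dm: "DIM(real ^ 'm) = Suc (n - 2)" using assms(1,3) by simp
  have sph: "hausdorff_outer (dim T - 1) (subspace_sphere T) = hausdorff_outer (n - 2) (sphere (0 :: real ^ 'm) 1)"
    unfolding k using dimT assms(3) by (intro hausdorff_outer_subspace_sphere subT) simp
  have fin: "hausdorff_outer (dim T - 1) (subspace_sphere T) < top"
    unfolding sph by (rule hausdorff_outer_sphere_finite[OF dm])
  have "measure (subspace_sphere_measure T) (subspace_sphere T) =
      enn2real (hausdorff_outer (dim T - 1) (subspace_sphere T))"
    using subspace_sphere_borel[OF subT]
    by (simp add: subspace_sphere_measure_def measure_def emeasure_restrict_space emeasure_hausdorff_measure)
  also have "\<dots> = \<omega>"
    unfolding sph \<omega>_def by (simp add: measure_def emeasure_hausdorff_measure)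
  finally have mT: "measure (subspace_sphere_measure T) (subspace_sphere T) = \<omega>" .
  have \<omega>: "0 < \<omega>"
    using hausdorff_outer_sphere_pos[OF dm] hausdorff_outer_sphere_finite[OF dm]
    by (simp add: \<omega>_def measure_def emeasure_hausdorff_measure enn2real_positive_iff)
  have vT: "v \<in> T" using v by (simp add: T_def)
  let ?I = "LINT e : subspace_sphere T | hausdorff_measure (n - 2). (e \<bullet> L e) *\<^sub>R ((real n + 1) *\<^sub>R (e \<otimes>\<^sub>t e) - mat 1)"
  have "L v \<bullet> w = ((((real n - 1) / (2 * \<omega>)) *\<^sub>R ?I) *v v) \<bullet> w" for w
  proof -
    \<comment> \<open>Equality in the ambient space is tested against all w. Since e, v and L v are
      tangential, the normal part of w drops out, also from the term of
      \<open>mat 1\<close>.\<close>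
    define w' where "w' = w - (N z \<bullet> w) *\<^sub>R N z"
    have w'T: "w' \<in> T" using nz by (simp add: w'_def T inner_diff_right norm_eq_1)
    have w': "u \<bullet> w = u \<bullet> w'" if "u \<in> T" for u
      using that by (simp add: w'_def T inner_diff_right inner_commute)
    have "(?I *v v) \<bullet> w = (LINT e | subspace_sphere_measure T. (e \<bullet> L e) * ((real n + 1) * ((e \<bullet> v) * (e \<bullet> w)) - v \<bullet> w))"
      using tensor_quadratic_integral[OF subT fin L(1), of "real n + 1" v w] unfolding k .
    also have "\<dots> = (LINT e | subspace_sphere_measure T. (e \<bullet> L e) * (real (dim T + 2) * ((e \<bullet> v) * (e \<bullet> w')) - v \<bullet> w'))"
    proof (rule Bochner_Integration.integral_cong)
      fix e assume "e \<in> space (subspace_sphere_measure T)"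
      then have "e \<in> T" by (simp add: subspace_sphere_def)
      then show "(e \<bullet> L e) * ((real n + 1) * ((e \<bullet> v) * (e \<bullet> w)) - v \<bullet> w) =
          (e \<bullet> L e) * (real (dim T + 2) * ((e \<bullet> v) * (e \<bullet> w')) - v \<bullet> w')"
        using assms(1) by (simp add: w' vT dimT of_nat_diff)
    qed simp
    finally have I: "(?I *v v) \<bullet> w = \<dots>" .
    have "real (dim T) * ((?I *v v) \<bullet> w) = 2 * \<omega> * (L v \<bullet> w)"
      unfolding I w'[OF L(2)[OF vT]] mT[symmetric]
      by (rule quadratic_form_moment[OF subT fin L vT w'T])
    moreover have "real (dim T) = real n - 1" using assms(1) by (simp add: dimT of_nat_diff)
    ultimately show ?thesis
      using \<omega> by (simp add: scaleR_matrix_vector_assoc[symmetric] field_simps)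
  qed
  then have "L v = (((real n - 1) / (2 * \<omega>)) *\<^sub>R ?I) *v v" by (rule vector_eq_rdot[THEN iffD1, OF allI])
  moreover have "unit_tangents S z = subspace_sphere T"
    by (simp add: unit_tangents_def subspace_sphere_def T_def)
  ultimately show "curvature_tensor S N z v =
      (((real n - 1) / (2 * measure (hausdorff_measure (n - 2)) (sphere (0 :: real ^ 'm) 1))) *\<^sub>R
        (LINT e : unit_tangents S z | hausdorff_measure (n - 2).
           directional_curvature S N z e *\<^sub>R ((real n + 1) *\<^sub>R (e \<otimes>\<^sub>t e) - mat 1))) *v v"
    unfolding L_def \<omega>_def directional_curvature_def by (simp only:)
qed

end
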